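(* Let $n,m\geq 1$, $\tau>0$, let $U\subseteq\mathbb{R}^m$ be compact, let $\mathcal{K}\subseteq\mathbb{R}^n$ be nonempty and compact, and let $f:\mathbb{R}^n\times U\to\mathbb{R}^n$. Assume: (i) $f$ is continuous and there are constants $M,L>0$ such that $|f(z,u)|\leq M$ and $|f(z,u)-f(y,u)|\leq L|z-y|$ for all $z,y\in\mathbb{R}^n$, $u\in U$; (ii) there exist $\mu,\sigma>0$ such that for every $x\in\mathcal{K}_\sigma\setminus\mathcal{K}$ there exists $u_x\in U$ with $$f(x,u_x)\cdot\frac{x-\pi(x)}{|x-\pi(x)|}\leq-\mu$$ for some $\pi(x)\in\mathcal{K}$ such that $d_{\mathcal{K}}(x)=|x-\pi(x)|$. Let $\bar M>0$, set $M^*:=\max\{M,\bar M\}$, and assume $\tau<\dfrac{\mu}{2M^*L}$. Then $\mathcal{R}_{M^*}$ is an open subset of $\mathrm{Lip}_{M^*}([-\tau,0];\mathbb{R}^n)$ and the minimum time functional $T$ associated with the delayed control system $y'(t)=f(y(t-\tau),u(t))$ and the target $\mathcal{K}$ is locally Lipschitz continuous in $\mathcal{R}_{M^*}$.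
   Context: $|\cdot|$ is the Euclidean norm on $\mathbb{R}^n$; $d_{\mathcal{K}}(z)=\inf_{y\in\mathcal{K}}|y-z|$; for $\rho>0$, $\mathcal{K}_\rho=\{z\in\mathbb{R}^n: d_{\mathcal{K}}(z)<\rho\}$. $C([-\tau,0];\mathbb{R}^n)$ is the Banach space of continuous functions $[-\tau,0]\to\mathbb{R}^n$ with norm $\|x\|_\infty=\sup_{s\in[-\tau,0]}|x(s)|$. A control is a measurable function $u:[0,\infty)\to U$. For $x\in C([-\tau,0];\mathbb{R}^n)$ and a control $u$, $y(\cdot;x,u)$ denotes the unique solution of the delayed system $y'(t)=f(y(t-\tau),u(t))$ for (a.e.) $t\geq0$, $y(s)=x(s)$ for $s\in[-\tau,0]$. Set $\theta(x,u)=\min\{t\geq0: y(t;x,u)\in\mathcal{K}\}\in[0,+\infty]$ (equal to $+\infty$ if the set is empty). The reachable set is $\mathcal{R}=\{x\in C([-\tau,0];\mathbb{R}^n):\theta(x,u)<+\infty\text{ for some control }u\}$, and the minimum time functional is $T:\mathcal{R}\to[0,+\infty)$, $T(x)=\inf_u\theta(x,u)$, the infimum being over all controls $u$. For a constant $N>0$, $\mathrm{Lip}_{N}([-\tau,0];\mathbb{R}^n)=\{x\in C([-\tau,0];\mathbb{R}^n):|x(s)-x(t)|\leq N|s-t|\ \forall s,t\in[-\tau,0]\}$ and $\mathcal{R}_{N}=\mathcal{R}\cap\mathrm{Lip}_{N}([-\tau,0];\mathbb{R}^n)$. Openness and local Lipschitz continuity are with respect to the metric induced by $\|\cdot\|_\infty$;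 $T$ is locally Lipschitz continuous in $\mathcal{R}_{M^*}$ if every $x_0\in\mathcal{R}_{M^*}$ has a neighbourhood in $\mathcal{R}_{M^*}$ on which $T$ is Lipschitz continuous with respect to $\|\cdot\|_\infty$. *)

theory Defs
  imports "HOL-Analysis.Analysis"
begin

text \<open>Initial data are elements of the library metric space of continuous functions on
  \<open>{-\<tau>..0}\<close>; its points are the functions that are \<open>undefined\<close> off that interval
  (\<^const>\<open>extensional\<close>), so that points are equal iff they agree on the interval,
  and its distance is the supremum distance.\<close>

definition history_space :: "real \<Rightarrow> (real \<Rightarrow> 'a::euclidean_space) metric" where
  "history_space \<tau> = cfunspace (top_of_set {-\<tau>..0}) euclidean_metric"

definition Lip_space :: "real \<Rightarrow> real \<Rightarrow> (real \<Rightarrow> 'a::euclidean_space) metric" where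
  "Lip_space N \<tau> = submetric (history_space \<tau>) {x. N-lipschitz_on {-\<tau>..0} x}"

definition locally_Lipschitz_map :: "'a metric \<Rightarrow> 'b metric \<Rightarrow> ('a \<Rightarrow> 'b) \<Rightarrow> bool" where
  "locally_Lipschitz_map m1 m2 g \<longleftrightarrow>
     (\<forall>x\<in>mspace m1. \<exists>V. openin (mtopology_of m1) V \<and> x \<in> V \<and>
        Lipschitz_continuous_map (submetric m1 V) m2 g)"

text \<open>Absolute continuity of a function on a real interval: the elements of a division are
  nonoverlapping compact intervals \<open>k = {Inf k..Sup k}\<close>.\<close>

definition abs_continuous_on :: "real set \<Rightarrow> (real \<Rightarrow> 'a::real_normed_vector) \<Rightarrow> bool" where
  "abs_continuous_on S y \<longleftrightarrow>
     (\<forall>\<epsilon>>0. \<exists>\<delta>>0. \<forall>d T. d division_of T \<and> T \<subseteq> S \<and> (\<Sum>k\<in>d. Sup k - Inf k) < \<delta> \<longrightarrow>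
        (\<Sum>k\<in>d. norm (y (Sup k) - y (Inf k))) < \<epsilon>)"

text \<open>Only the values of a control on \<open>{0..}\<close> matter; \<open>measurable\<close> means Lebesgue measurable.\<close>

definition controls :: "'b::euclidean_space set \<Rightarrow> (real \<Rightarrow> 'b) set" where
  "controls U = {u \<in> borel_measurable (lebesgue_on {0..}). \<forall>t\<ge>0. u t \<in> U}"

text \<open>Solutions in the sense of Caratheodory. They are normalised to be \<open>undefined\<close> before
  \<open>-\<tau>\<close>, so that uniqueness of the solution is uniqueness of the function.\<close>

definition is_solution ::
  "real \<Rightarrow> ('a::euclidean_space \<Rightarrow> 'b \<Rightarrow> 'a) \<Rightarrow> (real \<Rightarrow> 'a) \<Rightarrow> (real \<Rightarrow> 'b) \<Rightarrow> (real \<Rightarrow> 'a) \<Rightarrow> bool" where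
  "is_solution \<tau> f x u y \<longleftrightarrow>
     y \<in> extensional {-\<tau>..} \<and>
     (\<forall>s\<in>{-\<tau>..0}. y s = x s) \<and>
     (\<forall>b\<ge>0. abs_continuous_on {0..b} y) \<and>
     (AE t in lebesgue_on {0..}. (y has_vector_derivative f (y (t - \<tau>)) (u t)) (at t))"

definition trajectory ::
  "real \<Rightarrow> ('a::euclidean_space \<Rightarrow> 'b \<Rightarrow> 'a) \<Rightarrow> (real \<Rightarrow> 'a) \<Rightarrow> (real \<Rightarrow> 'b) \<Rightarrow> (real \<Rightarrow> 'a)" where
  "trajectory \<tau> f x u = (THE y. is_solution \<tau> f x u y)"

definition hitting_time ::
  "real \<Rightarrow> ('a::euclidean_space \<Rightarrow> 'b \<Rightarrow> 'a) \<Rightarrow> 'a set \<Rightarrow> (real \<Rightarrow> 'a) \<Rightarrow> (real \<Rightarrow> 'b) \<Rightarrow> ereal" where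
  "hitting_time \<tau> f K x u =
     (if \<exists>t\<ge>0. trajectory \<tau> f x u t \<in> K
      then ereal (LEAST t. t \<ge> 0 \<and> trajectory \<tau> f x u t \<in> K) else \<infinity>)"

definition reachable ::
  "real \<Rightarrow> ('a::euclidean_space \<Rightarrow> 'b::euclidean_space \<Rightarrow> 'a) \<Rightarrow> 'b set \<Rightarrow> 'a set \<Rightarrow> (real \<Rightarrow> 'a) set" where
  "reachable \<tau> f U K =
     {x \<in> mspace (history_space \<tau>). \<exists>u\<in>controls U. hitting_time \<tau> f K x u < \<infinity>}"

text \<open>The infimum is finite on the reachable set, which is the domain of the functional; values elsewhere are irrelevant.\<close>

definition min_time ::
  "real \<Rightarrow> ('a::euclidean_space \<Rightarrow> 'b::euclidean_space \<Rightarrow> 'a) \<Rightarrow> 'b set \<Rightarrow> 'a set \<Rightarrow> (real \<Rightarrow> 'a) \<Rightarrow> real" where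
  "min_time \<tau> f U K x = real_of_ereal (INF u\<in>controls U. hitting_time \<tau> f K x u)"

definition reachable_Lip ::
  "real \<Rightarrow> real \<Rightarrow> ('a::euclidean_space \<Rightarrow> 'b::euclidean_space \<Rightarrow> 'a) \<Rightarrow> 'b set \<Rightarrow> 'a set \<Rightarrow> (real \<Rightarrow> 'a) set" where
  "reachable_Lip N \<tau> f U K = reachable \<tau> f U K \<inter> mspace (Lip_space N \<tau>)"

end

theory Submission
  imports Defs
begin

text \<open>On each interval of length \<open>\<tau>\<close> the right-hand side of the delayed equation is known from
  the previous interval, so trajectories are obtained by integration, and they depend Lipschitz
  continuously on the initial datum up to any fixed time. Near the target, steer with the control
  of hypothesis (ii) at the current position \<open>z\<close>: since trajectories are \<open>M*\<close>-Lipschitz, the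
  delayed position is within \<open>M*\<tau>\<close> of \<open>z\<close>, and the distance to the target decreases at rate at
  least \<open>\<mu> - L M*\<tau> > 0\<close>. Renewing the choice after a time proportional to the remaining distance
  makes the distances decay geometrically, so the target is reached within a time proportional to
  the initial distance. A control that is good for one datum thus brings every nearby datum close
  to the target, at a distance and hence at an additional cost proportional to the perturbation.\<close>

section \<open>Lebesgue differentiation and absolute continuity on the line\<close>

text \<open>If the difference quotients at \<open>x\<close> stay away from \<open>g x\<close>, then \<open>x\<close> lies in arbitrarily short
  intervals on which the Riemann term and the integral differ by a fixed proportion of the length. A
  Vitali subfamily of such intervals has small total length by the Henstock lemma.\<close>

lemma negligible_not_has_vector_derivative_indefinite_integral:
  fixes g :: "real \<Rightarrow> 'a::euclidean_space"
  assumes g: "g integrable_on {a..b}"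
  shows "negligible {x \<in> {a<..<b}. \<not> ((\<lambda>t. integral {a..t} g) has_vector_derivative g x) (at x)}"
proof -
  define F where "F t = integral {a..t} g" for t
  define bad where "bad k x h \<longleftrightarrow> norm (F (x + h) - F x - h *\<^sub>R g x) > \<bar>h\<bar> / real (Suc k)" for k x h
  define E where "E k = {x \<in> {a<..<b}. \<forall>d>0. \<exists>h. h \<noteq> 0 \<and> \<bar>h\<bar> < d \<and> bad k x h}" for k
  \<comment> \<open>A ball about the midpoint is the interval between \<open>x\<close> and
    \<open>x + h\<close> for either sign of \<open>h\<close>, in the shape that Vitali's theorem for
    balls accepts.\<close>
  define I where "I x h = cball (x + h / 2) (\<bar>h\<bar> / 2)" for x h :: real
  have I_eq: "I x h = {min x (x + h)..max x (x + h)}" for x h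
    unfolding I_def cball_eq_atLeastAtMost by (auto simp: min_def max_def abs_if field_simps)
  have integral_I: "norm (measure lborel (I x h) *\<^sub>R g x - integral (I x h) g) = norm (F (x + h) - F x - h *\<^sub>R g x)"
    if "x \<in> {a..b}" "x + h \<in> {a..b}" for x h
  proof (cases "h \<ge> 0")
    case True
    have "integral {a..x} g + integral {x..x+h} g = integral {a..x+h} g"
      using True that by (intro Henstock_Kurzweil_Integration.integral_combine integrable_on_subinterval[OF g]) auto
    then have "integral (I x h) g = F (x + h) - F x"
      using True by (simp add: I_eq F_def algebra_simps)
    moreover have "measure lborel (I x h) = h" using True by (simp add: I_eq)
    ultimately show ?thesis by (simp add: norm_minus_commute)
  next
    case False
    have "integral {a..x+h} g + integral {x+h..x} g = integral {a..x} g"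
      using False that by (intro Henstock_Kurzweil_Integration.integral_combine integrable_on_subinterval[OF g]) auto
    then have 1: "integral (I x h) g = F x - F (x + h)"
      using False by (simp add: I_eq F_def algebra_simps)
    have 2: "measure lborel (I x h) = - h" using False by (simp add: I_eq)
    show ?thesis unfolding 1 2 by (simp add: algebra_simps)
  qed
  have "negligible (E k)" for k
    unfolding negligible_outer_le
  proof (intro allI impI)
    fix e :: real
    assume "e > 0"
    \<comment> \<open>A bad interval is at most \<open>Suc k\<close> times as long as its Henstock
      error, so the tolerance is divided by this factor in advance.\<close>
    then have "e / real (Suc k) > 0" by simp
    then obtain \<gamma> where "gauge \<gamma>" and \<gamma>: "\<And>p. \<lbrakk>p tagged_partial_division_of (cbox a b); \<gamma> fine p\<rbrakk> \<Longrightarrow>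
             sum (\<lambda>(x,k). norm(measure lborel k *\<^sub>R g x - integral k g)) p < e / real (Suc k)"
      using Henstock_lemma[of g a b "e / real (Suc k)"] g unfolding box_real by blast
    define P where "P = {(x, h). x \<in> E k \<and> h \<noteq> 0 \<and> I x h \<subseteq> \<gamma> x \<and> x + h \<in> {a..b} \<and> bad k x h}"
    have "\<exists>i. i \<in> P \<and> x \<in> cball (fst i + snd i / 2) (\<bar>snd i\<bar> / 2) \<and> \<bar>snd i\<bar> / 2 < d"
      if x: "x \<in> E k" and "d > 0" for x d
    proof -
      \<comment> \<open>The intersection with the open interval keeps \<open>x + h\<close> inside
        \<open>{a..b}\<close> for small \<open>h\<close>.\<close>
      have "open (\<gamma> x \<inter> {a<..<b})" "x \<in> \<gamma> x \<inter> {a<..<b}"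
        using \<open>gauge \<gamma>\<close> x by (auto simp: gauge_def E_def)
      then obtain r where "r > 0" and r: "ball x r \<subseteq> \<gamma> x \<inter> {a<..<b}"
        using open_contains_ball by blast
      then obtain h where h: "h \<noteq> 0" "\<bar>h\<bar> < min r d" "bad k x h"
        using x \<open>d > 0\<close> unfolding E_def by (auto dest!: spec[of _ "min r d"])
      have "I x h \<subseteq> ball x r"
        using h(2) by (auto simp: I_eq dist_real_def min_def max_def split: if_splits)
      moreover have "x + h \<in> {a<..<b}"
        using h(2) subsetD[OF r, of "x + h"] by (auto simp: dist_real_def)
      ultimately have "(x, h) \<in> P"
        using x h r by (auto simp: P_def subset_iff)
      moreover have "x \<in> I x h" by (simp add: I_eq)
      ultimately show ?thesis
        using h by (intro exI[of _ "(x, h)"]) (auto simp: I_def)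
    qed
    then obtain C where C: "countable C" "C \<subseteq> P"
      and disj: "pairwise (\<lambda>i j. disjnt (cball (fst i + snd i / 2) (\<bar>snd i\<bar> / 2)) (cball (fst j + snd j / 2) (\<bar>snd j\<bar> / 2))) C"
      and neg: "negligible (E k - (\<Union>i \<in> C. cball (fst i + snd i / 2) (\<bar>snd i\<bar> / 2)))"
      using Vitali_covering_theorem_cballs[of P "\<lambda>i. \<bar>snd i\<bar> / 2" "E k" "\<lambda>i. fst i + snd i / 2"]
      by (force simp: P_def)
    let ?J = "\<lambda>i. I (fst i) (snd i)"
    \<comment> \<open>The measure of the countable union will be bounded through its finite
      subunions, where the Henstock sum makes sense.\<close>
    have bound: "measure lebesgue (\<Union>i\<in>D. ?J i) \<le> e" if D: "D \<subseteq> C" "finite D" for D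
    proof -
      have J_disj: "?J i \<inter> ?J j = {}" if "i \<in> D" "j \<in> D" "i \<noteq> j" for i j
        using pairwiseD[OF disj, of i j] that D by (auto simp: I_def disjnt_def)
      have mem: "fst i \<in> ?J i" for i :: "real \<times> real"
        by (simp add: I_eq)
      \<comment> \<open>Each tag lies in its own interval and the intervals are disjoint, so the sum
        over \<open>p\<close> can be reindexed by \<open>D\<close>.\<close>
      have inj: "inj_on (\<lambda>i. (fst i, ?J i)) D"
        using J_disj mem by (fastforce simp: inj_on_def)
      define p where "p = (\<lambda>i. (fst i, ?J i)) ` D"
      have inP: "i \<in> P" if "i \<in> D" for i using that D C by auto
      have tag: "p tagged_partial_division_of cbox a b"
        unfolding tagged_partial_division_of_def p_def
      proof (intro conjI allI impI)
        show "finite ((\<lambda>i. (fst i, ?J i)) ` D)" using D by simp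
      next
        fix x K assume "(x, K) \<in> (\<lambda>i. (fst i, ?J i)) ` D"
        then obtain i where i: "i \<in> D" "x = fst i" "K = ?J i" by auto
        then show "x \<in> K" using mem by auto
        show "K \<subseteq> cbox a b" using i inP[OF i(1)] by (auto simp: I_eq P_def E_def)
        show "\<exists>a b. K = cbox a b" using i by (auto simp: I_eq)
      next
        fix x K x' K'
        assume "(x, K) \<in> (\<lambda>i. (fst i, ?J i)) ` D \<and> (x', K') \<in> (\<lambda>i. (fst i, ?J i)) ` D \<and> (x, K) \<noteq> (x', K')"
        then obtain i j where "i \<in> D" "j \<in> D" "i \<noteq> j" "K = ?J i" "K' = ?J j" by auto
        then have "K \<inter> K' = {}" using J_disj by auto
        then show "interior K \<inter> interior K' = {}"
          using interior_subset by blast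
      qed
      moreover have "\<gamma> fine p"
        using inP by (force simp: fine_def p_def P_def)
      ultimately have lt: "(\<Sum>(x, K)\<in>p. norm (measure lborel K *\<^sub>R g x - integral K g)) < e / real (Suc k)"
        by (rule \<gamma>)
      have "measure lebesgue (\<Union>i\<in>D. ?J i) \<le> (\<Sum>i\<in>D. measure lebesgue (?J i))"
        using D by (intro measure_UNION_le) (auto simp: I_def)
      also have "\<dots> = (\<Sum>i\<in>D. \<bar>snd i\<bar>)"
        by (intro sum.cong refl) (auto simp: I_eq measure_completion)
      also have "\<dots> \<le> (\<Sum>i\<in>D. real (Suc k) * norm (measure lborel (?J i) *\<^sub>R g (fst i) - integral (?J i) g))"
      proof (intro sum_mono)
        fix i assume "i \<in> D"
        then have "i \<in> P" by (rule inP)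
        then have 1: "fst i \<in> {a..b}" "fst i + snd i \<in> {a..b}" "bad k (fst i) (snd i)"
          by (auto simp: P_def E_def)
        then show "\<bar>snd i\<bar> \<le> real (Suc k) * norm (measure lborel (?J i) *\<^sub>R g (fst i) - integral (?J i) g)"
          unfolding integral_I[OF 1(1,2)] by (simp add: bad_def divide_less_eq mult.commute)
      qed
      also have "\<dots> = real (Suc k) * (\<Sum>(x, K)\<in>p. norm (measure lborel K *\<^sub>R g x - integral K g))"
        unfolding p_def by (simp add: sum.reindex[OF inj] sum_distrib_left)
      also have "\<dots> \<le> real (Suc k) * (e / real (Suc k))"
        using lt by (intro mult_left_mono) auto
      finally show ?thesis by simp
    qed
    let ?T = "\<Union>i\<in>C. ?J i"
    have T: "?T \<in> lmeasurable" "measure lebesgue ?T \<le> e"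
      using fmeasurable_UN_bound[OF C(1) _ bound] measure_UN_bound[OF C(1) _ bound] by (auto simp: I_def)
    have neg: "negligible (E k - ?T)" using neg by (simp add: I_def)
    have N: "E k - ?T \<in> lmeasurable" "measure lebesgue (E k - ?T) = 0"
      using neg by (auto intro: negligible_imp_measurable negligible_imp_measure0)
    \<comment> \<open>\<open>?T\<close> covers \<open>E k\<close> only up to the null set left by
      Vitali, which is added back.\<close>
    have "measure lebesgue ((E k - ?T) \<union> ?T) \<le> measure lebesgue (E k - ?T) + measure lebesgue ?T"
      using T N by (intro measure_Un_le) (auto intro: fmeasurableD)
    then have "measure lebesgue ((E k - ?T) \<union> ?T) \<le> e" using T N by simp
    then show "\<exists>T. E k \<subseteq> T \<and> T \<in> lmeasurable \<and> measure lebesgue T \<le> e"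
      using fmeasurable.Un[OF N(1) T(1)] by (intro exI[of _ "(E k - ?T) \<union> ?T"]) blast
  qed
  then have "negligible (\<Union>k. E k)"
    by (intro negligible_countable_Union) auto
  moreover have "{x \<in> {a<..<b}. \<not> (F has_vector_derivative g x) (at x)} \<subseteq> (\<Union>k. E k)"
  proof (safe, rule ccontr)
    fix x assume x: "x \<in> {a<..<b}" and nE: "x \<notin> (\<Union>k. E k)" and nd: "\<not> (F has_vector_derivative g x) (at x)"
    have "\<exists>d>0. \<forall>y. norm (y - x) < d \<longrightarrow> norm (F y - F x - (y - x) *\<^sub>R g x) \<le> e * norm (y - x)" if "e > 0" for e
    proof -
      obtain k where k: "1 / real (Suc k) < e" using \<open>e > 0\<close> nat_approx_posE by blast
      obtain d where d: "d > 0" "\<And>h. h \<noteq> 0 \<Longrightarrow> \<bar>h\<bar> < d \<Longrightarrow> \<not> bad k x h"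
        using nE x unfolding E_def by blast
      have "norm (F y - F x - (y - x) *\<^sub>R g x) \<le> e * norm (y - x)" if y: "norm (y - x) < d" for y
      proof (cases "y = x")
        case False
        have "norm (F y - F x - (y - x) *\<^sub>R g x) \<le> (1 / real (Suc k)) * \<bar>y - x\<bar>"
          using d(2)[of "y - x"] False y by (simp add: bad_def)
        also have "\<dots> \<le> e * \<bar>y - x\<bar>" using k by (intro mult_right_mono) auto
        finally show ?thesis by simp
      qed simp
      then show ?thesis using d(1) by blast
    qed
    then have "(F has_vector_derivative g x) (at x)"
      unfolding has_vector_derivative_def has_derivative_at_alt
      by (auto intro: bounded_linear_scaleR_left)
    with nd show False ..
  qed
  ultimately show ?thesis
    unfolding F_def[abs_def] by (rule negligible_subset)
qed

section \<open>Absolutely continuous functions\<close>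

lemma abs_continuous_on_diff:
  assumes "abs_continuous_on S y" "abs_continuous_on S z"
  shows "abs_continuous_on S (\<lambda>t. y t - z t)"
  unfolding abs_continuous_on_def
proof (intro allI impI)
  fix e :: real assume "e > 0"
  then have "e / 2 > 0" by simp
  obtain d1 where "d1 > 0"
    and 1: "\<And>d T. d division_of T \<and> T \<subseteq> S \<and> (\<Sum>k\<in>d. Sup k - Inf k) < d1 \<Longrightarrow>
        (\<Sum>k\<in>d. norm (y (Sup k) - y (Inf k))) < e / 2"
    using assms(1) \<open>e / 2 > 0\<close> unfolding abs_continuous_on_def by blast
  obtain d2 where "d2 > 0"
    and 2: "\<And>d T. d division_of T \<and> T \<subseteq> S \<and> (\<Sum>k\<in>d. Sup k - Inf k) < d2 \<Longrightarrow>
        (\<Sum>k\<in>d. norm (z (Sup k) - z (Inf k))) < e / 2"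
    using assms(2) \<open>e / 2 > 0\<close> unfolding abs_continuous_on_def by blast
  have "(\<Sum>k\<in>d. norm (y (Sup k) - z (Sup k) - (y (Inf k) - z (Inf k)))) < e"
    if "d division_of T" "T \<subseteq> S" "(\<Sum>k\<in>d. Sup k - Inf k) < min d1 d2" for d T
  proof -
    have "(\<Sum>k\<in>d. norm (y (Sup k) - z (Sup k) - (y (Inf k) - z (Inf k))))
      \<le> (\<Sum>k\<in>d. norm (y (Sup k) - y (Inf k)) + norm (z (Sup k) - z (Inf k)))"
    proof (intro sum_mono)
      fix k
      show "norm (y (Sup k) - z (Sup k) - (y (Inf k) - z (Inf k)))
          \<le> norm (y (Sup k) - y (Inf k)) + norm (z (Sup k) - z (Inf k))"
        using norm_triangle_ineq4[of "y (Sup k) - y (Inf k)" "z (Sup k) - z (Inf k)"] by (simp add: algebra_simps)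
    qed
    with 1[of d T] 2[of d T] that show ?thesis by (simp add: sum.distrib)
  qed
  then show "\<exists>\<delta>>0. \<forall>d T. d division_of T \<and> T \<subseteq> S \<and> (\<Sum>k\<in>d. Sup k - Inf k) < \<delta> \<longrightarrow>
          (\<Sum>k\<in>d. norm (y (Sup k) - z (Sup k) - (y (Inf k) - z (Inf k)))) < e"
    using \<open>d1 > 0\<close> \<open>d2 > 0\<close> by (intro exI[of _ "min d1 d2"]) auto
qed

lemma lipschitz_on_imp_abs_continuous_on:
  assumes "N-lipschitz_on S y"
  shows "abs_continuous_on S y"
  unfolding abs_continuous_on_def
proof (intro allI impI)
  fix e :: real assume "e > 0"
  have N: "N \<ge> 0" using assms lipschitz_on_nonneg by blast
  \<comment> \<open>\<open>N + 1\<close> in place of \<open>N\<close> keeps the quotient meaningful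
    when \<open>N = 0\<close>.\<close>
  have "(\<Sum>k\<in>d. norm (y (Sup k) - y (Inf k))) < e"
    if d: "d division_of T" "T \<subseteq> S" "(\<Sum>k\<in>d. Sup k - Inf k) < e / (N + 1)" for d T
  proof -
    have "(\<Sum>k\<in>d. norm (y (Sup k) - y (Inf k))) \<le> (\<Sum>k\<in>d. (N + 1) * (Sup k - Inf k))"
    proof (intro sum_mono)
      fix k assume "k \<in> d"
      obtain u v where "k = cbox u v"
        using division_ofD(4)[OF d(1) \<open>k \<in> d\<close>] by auto
      with division_ofD(2,3)[OF d(1) \<open>k \<in> d\<close>] have k: "k = {u..v}" "u \<le> v" "k \<subseteq> T"
        by auto
      then have "norm (y v - y u) \<le> N * (v - u)"
        using lipschitz_onD[OF assms, of v u] d(2) k by (auto simp: dist_norm subset_iff)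
      also have "\<dots> \<le> (N + 1) * (v - u)" using k by (intro mult_right_mono) auto
      finally show "norm (y (Sup k) - y (Inf k)) \<le> (N + 1) * (Sup k - Inf k)" using k by simp
    qed
    also have "\<dots> = (N + 1) * (\<Sum>k\<in>d. Sup k - Inf k)" by (simp add: sum_distrib_left)
    also have "\<dots> < e" using d(3) N by (simp add: pos_less_divide_eq mult.commute)
    finally show ?thesis .
  qed
  then show "\<exists>\<delta>>0. \<forall>d T. d division_of T \<and> T \<subseteq> S \<and> (\<Sum>k\<in>d. Sup k - Inf k) < \<delta> \<longrightarrow>
          (\<Sum>k\<in>d. norm (y (Sup k) - y (Inf k))) < e"
    using \<open>e > 0\<close> N by (intro exI[of _ "e / (N + 1)"]) auto
qed

text \<open>In a gauge-fine division, intervals tagged outside \<open>E\<close> contribute little by the zero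
  derivative, and those tagged in \<open>E\<close> lie in an open set of small measure, where absolute
  continuity applies.\<close>

lemma abs_continuous_on_zero_derivative_eq:
  fixes y :: "real \<Rightarrow> 'a::real_normed_vector"
  assumes "a \<le> b" and ac: "abs_continuous_on {a..b} y" and E: "negligible E"
    and deriv: "\<And>x. x \<in> {a..b} - E \<Longrightarrow> (y has_vector_derivative 0) (at x within {a..b})"
  shows "y b = y a"
proof -
  have le: "norm (y b - y a) \<le> e * (b - a + 1)" if "e > 0" for e
  proof -
    obtain \<delta> where "\<delta> > 0" and \<delta>: "\<And>d T. d division_of T \<Longrightarrow> T \<subseteq> {a..b} \<Longrightarrow> (\<Sum>k\<in>d. Sup k - Inf k) < \<delta> \<Longrightarrow>
        (\<Sum>k\<in>d. norm (y (Sup k) - y (Inf k))) < e"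
      using ac \<open>e > 0\<close> unfolding abs_continuous_on_def by meson
    \<comment> \<open>Outer regularity bounds \<open>T - E\<close>; since \<open>E\<close> is null,
      the whole open set \<open>T\<close> has measure below the threshold of absolute
      continuity.\<close>
    obtain T where T: "open T" "E \<subseteq> T" "(T - E) \<in> lmeasurable" "emeasure lebesgue (T - E) < ennreal \<delta>"
      using sets_lebesgue_outer_open[OF negligible_imp_sets[OF E] \<open>\<delta> > 0\<close>] .
    have "T = (T - E) \<union> E" using T by auto
    have Em: "E \<in> lmeasurable" "measure lebesgue E = 0"
      using E by (auto intro: negligible_imp_measurable negligible_imp_measure0)
    have "measure lebesgue (T - E) < \<delta>"
      using T(3,4) \<open>\<delta> > 0\<close> by (simp add: emeasure_eq_measure2 ennreal_less_iff)
    moreover have "measure lebesgue ((T - E) \<union> E) \<le> measure lebesgue (T - E) + measure lebesgue E"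
      using T(3) Em by (intro measure_Un_le) (auto intro: fmeasurableD)
    moreover have "(T - E) \<union> E \<in> lmeasurable" using T(3) Em by (intro fmeasurable.Un)
    ultimately have Tm: "T \<in> lmeasurable" "measure lebesgue T < \<delta>"
      using \<open>T = _\<close> Em by auto
    have "\<exists>d>0. \<forall>z\<in>{a..b}. norm (z - x) < d \<longrightarrow> norm (y z - y x) \<le> e * norm (z - x)" if "x \<in> {a..b} - E" for x
      using deriv[OF that] \<open>e > 0\<close> unfolding has_vector_derivative_def has_derivative_within_alt by auto
    then obtain d where d: "\<And>x. x \<in> {a..b} - E \<Longrightarrow> d x > 0"
      "\<And>x z. x \<in> {a..b} - E \<Longrightarrow> z \<in> {a..b} \<Longrightarrow> norm (z - x) < d x \<Longrightarrow> norm (y z - y x) \<le> e * norm (z - x)"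
      by metis
    \<comment> \<open>Intervals tagged in \<open>E\<close> are confined to \<open>T\<close>, the
      others to balls on which difference quotients at the tag are at most \<open>e\<close>. No tag
      lies outside \<open>{a..b}\<close>, so \<open>UNIV\<close> is a default there.\<close>
    define \<gamma> where "\<gamma> x = (if x \<in> E then T else if x \<in> {a..b} then ball x (d x) else UNIV)" for x
    have "gauge \<gamma>"
      using T d by (auto simp: gauge_def \<gamma>_def)
    then obtain p where p: "p tagged_division_of {a..b}" "\<gamma> fine p"
      by (rule fine_division_exists_real)
    have fin: "finite p" using p by auto
    have K: "\<exists>u v. K = {u..v} \<and> u \<le> v \<and> x \<in> {u..v} \<and> {u..v} \<subseteq> {a..b} \<and> {u..v} \<subseteq> \<gamma> x" if xK: "(x, K) \<in> p" for x K
    proof -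
      obtain u v where "K = {u..v}" using tagged_division_ofD(4)[OF p(1) xK] by auto
      then show ?thesis using p(2) xK tagged_division_ofD(2,3)[OF p(1) xK] by (auto simp: fine_def)
    qed
    let ?D = "\<lambda>K. norm (y (Sup K) - y (Inf K))"
    define p1 where "p1 = {(x, K) \<in> p. x \<in> E}"
    define p2 where "p2 = {(x, K) \<in> p. x \<notin> E}"
    have p12: "p = p1 \<union> p2" "p1 \<inter> p2 = {}" "finite p1" "finite p2" "p1 \<subseteq> p" "p2 \<subseteq> p"
      using fin by (auto simp: p1_def p2_def intro: finite_subset[OF _ fin])
    \<comment> \<open>Absolute continuity speaks of divisions without tags. An interval that carries
      two tags has empty interior, hence is a single point, where \<open>h\<close> vanishes.\<close>
    have nontriv: "(\<Sum>(x, K)\<in>p1. h K) = (\<Sum>K\<in>snd ` p1. h K)"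
      if "\<And>u. h {u} = (0::real)" for h
    proof -
      have "sum h (snd ` p1) = sum (h \<circ> snd) p1"
      proof (rule sum.reindex_nontrivial)
        fix i j assume ij: "i \<in> p1" "j \<in> p1" "i \<noteq> j" "snd i = snd j"
        then have *: "(fst i, snd i) \<in> p" "(fst j, snd i) \<in> p" "(fst i, snd i) \<noteq> (fst j, snd i)"
          using p12(5) by (auto simp: prod_eq_iff) (metis prod.collapse subsetD)
        then have "interior (snd i) = {}"
          using tagged_division_ofD(5)[OF p(1) *] by simp
        with K[OF *(1)] obtain u where "snd i = {u}" by force
        then show "h (snd i) = 0" using that by simp
      qed (use p12 in auto)
      then show ?thesis by (simp add: case_prod_unfold o_def)
    qed
    have "p1 tagged_partial_division_of {a..b}"
      using p p12 by (meson tagged_division_of_def tagged_partial_division_subset)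
    then have div1: "snd ` p1 division_of \<Union>(snd ` p1)"
      by (rule partial_division_of_tagged_division)
    have sub1: "\<Union>(snd ` p1) \<subseteq> {a..b}" "\<Union>(snd ` p1) \<subseteq> T"
      using K by (fastforce simp: p1_def \<gamma>_def)+
    have "(\<Sum>K\<in>snd ` p1. Sup K - Inf K) = sum (measure lborel) (snd ` p1)"
    proof (rule sum.cong)
      fix K' assume "K' \<in> snd ` p1"
      then obtain x where "(x, K') \<in> p" by (auto simp: p1_def)
      from K[OF this] show "Sup K' - Inf K' = measure lborel K'" by auto
    qed simp
    also have "\<dots> = measure lebesgue (\<Union>(snd ` p1))"
      unfolding content_division[OF div1, symmetric]
      using div1 by (intro sum.cong) (auto simp: measure_completion)
    also have "\<dots> \<le> measure lebesgue T"
      using sub1 Tm div1 by (intro measure_mono_fmeasurable) (auto intro!: fmeasurableD lmeasurable_division)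
    finally have "(\<Sum>K\<in>snd ` p1. ?D K) < e"
      using Tm by (intro \<delta>[OF div1 sub1(1)]) auto
    then have S1: "(\<Sum>(x, K)\<in>p1. ?D K) < e"
      by (subst nontriv) auto
    \<comment> \<open>Both endpoints are compared with the tag between them, so the two errors add
      up to \<open>e\<close> times the length.\<close>
    have "(\<Sum>(x, K)\<in>p2. ?D K) \<le> (\<Sum>(x, K)\<in>p2. e * measure lborel K)"
    proof (intro sum_mono, clarify)
      fix x K' assume xK: "(x, K') \<in> p2"
      then obtain u v where uv: "K' = {u..v}" "u \<le> v" "x \<in> {u..v}" "{u..v} \<subseteq> {a..b}" "{u..v} \<subseteq> \<gamma> x"
        using K p12 by blast
      have x: "x \<in> {a..b} - E" using xK uv by (auto simp: p2_def)
      then have "{u..v} \<subseteq> ball x (d x)" using uv by (simp add: \<gamma>_def)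
      then have "u \<in> ball x (d x)" "v \<in> ball x (d x)"
        using uv(2) by auto
      then have "norm (u - x) < d x" "norm (v - x) < d x"
        by (simp_all add: dist_real_def abs_minus_commute)
      then have "norm (y u - y x) \<le> e * norm (u - x)" "norm (y v - y x) \<le> e * norm (v - x)"
        using uv by (auto intro!: d(2)[OF x] simp del: real_norm_def)
      moreover have "norm (y v - y u) \<le> norm (y v - y x) + norm (y u - y x)"
        using norm_triangle_ineq4[of "y v - y x" "y u - y x"] by simp
      moreover have "e * norm (u - x) + e * norm (v - x) = e * (v - u)"
        using uv by (simp add: algebra_simps)
      ultimately show "?D K' \<le> e * measure lborel K'" using uv by simp
    qed
    also have "\<dots> \<le> (\<Sum>(x, K)\<in>p. e * measure lborel K)"
      using \<open>e > 0\<close> fin p12 by (intro sum_mono2) auto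
    also have "\<dots> = e * (b - a)"
      using additive_content_tagged_division[of p a b] p \<open>a \<le> b\<close>
      by (simp add: sum_distrib_left[symmetric] case_prod_unfold)
    finally have S2: "(\<Sum>(x, K)\<in>p2. ?D K) \<le> e * (b - a)" .
    have "norm (y b - y a) = norm (\<Sum>(x, K)\<in>p. y (Sup K) - y (Inf K))"
      using additive_tagged_division_1[OF \<open>a \<le> b\<close> p(1), of y] by simp
    also have "\<dots> \<le> (\<Sum>(x, K)\<in>p. ?D K)"
      by (simp add: case_prod_unfold norm_sum)
    also have "\<dots> = (\<Sum>(x, K)\<in>p1. ?D K) + (\<Sum>(x, K)\<in>p2. ?D K)"
      unfolding p12(1) by (rule sum.union_disjoint[OF p12(3,4,2)])
    finally show ?thesis using S1 S2 by (simp add: algebra_simps)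
  qed
  have "norm (y b - y a) \<le> 0 + e" if "e > 0" for e
  proof -
    have "b - a + 1 > 0" using \<open>a \<le> b\<close> by simp
    then show ?thesis using le[of "e / (b - a + 1)"] that by simp
  qed
  then have "norm (y b - y a) \<le> 0" by (rule field_le_epsilon)
  then show ?thesis by simp
qed

section \<open>Integrals of bounded functions\<close>

lemma norm_integral_le_const:
  fixes g :: "real \<Rightarrow> 'a::euclidean_space"
  assumes "g integrable_on {a..b}" "a \<le> b" "\<And>s. s \<in> {a..b} \<Longrightarrow> norm (g s) \<le> B"
  shows "norm (integral {a..b} g) \<le> B * (b - a)"
proof -
  have "B \<ge> 0"
    using assms(2) order_trans[OF norm_ge_zero assms(3)[of a]] by auto
  then show ?thesis
    using has_integral_bound_real[OF _ _ integrable_integral[OF assms(1)], of B "{}"] assms by simp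
qed

text \<open>For \<open>t < a\<close> the integral is over an empty interval and vanishes, so the
  estimate extends to the whole line. This makes Picard iterates continuous across time 0.\<close>

lemma lipschitz_on_indefinite_integral:
  fixes g :: "real \<Rightarrow> 'a::euclidean_space"
  assumes int: "\<And>b. g integrable_on {a..b}" and bound: "\<And>s. s \<ge> a \<Longrightarrow> norm (g s) \<le> B"
  shows "B-lipschitz_on UNIV (\<lambda>t. integral {a..t} g)"
proof (rule lipschitz_onI)
  show B: "0 \<le> B" using order_trans[OF norm_ge_zero bound[of a]] by simp
  have le: "norm (integral {a..t} g - integral {a..s} g) \<le> B * (t - s)" if "s \<le> t" for s t
  proof (cases "s \<ge> a")
    case True
    have "integral {a..s} g + integral {s..t} g = integral {a..t} g"
      using True that int by (intro Henstock_Kurzweil_Integration.integral_combine) auto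
    then have "integral {a..t} g - integral {a..s} g = integral {s..t} g"
      by (simp add: algebra_simps)
    moreover have "norm (integral {s..t} g) \<le> B * (t - s)"
      using True that by (intro norm_integral_le_const bound integrable_subinterval_real[OF int[of t]]) auto
    ultimately show ?thesis by simp
  next
    case s: False
    show ?thesis
    proof (cases "t \<ge> a")
      case True
      have "norm (integral {a..t} g) \<le> B * (t - a)"
        using True by (intro norm_integral_le_const bound int) auto
      also have "\<dots> \<le> B * (t - s)" using B s by (intro mult_left_mono) auto
      finally show ?thesis using s by simp
    next
      case False
      then show ?thesis using s B that by simp
    qed
  qed
  show "dist (integral {a..s} g) (integral {a..t} g) \<le> B * dist s t" for s t
    using le[of s t] le[of t s]
    by (cases "s \<le> t") (auto simp: dist_norm dist_real_def norm_minus_commute)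
qed

section \<open>Controls and spaces of initial data\<close>

lemma controls_If:
  assumes "u \<in> controls U" "v \<in> controls U"
  shows "(\<lambda>s. if s < t then u s else v s) \<in> controls U"
proof -
  have "(\<lambda>s. if s \<in> {..<t} then u s else v s) \<in> borel_measurable (lebesgue_on {0..})"
    using assms unfolding controls_def
    by (intro measurable_If_set) (auto simp: sets_restrict_space)
  then show ?thesis
    using assms by (auto simp: controls_def)
qed

lemma controls_const: "c \<in> U \<Longrightarrow> (\<lambda>_. c) \<in> controls U"
  by (simp add: controls_def)

text \<open>Meant for controls pieced together in infinitely many stages: at each time the stages
  are eventually constant, so the values stay in \<open>U\<close>, and pointwise limits preserve
  measurability.\<close>

lemma controls_LIMSEQ:
  assumes "\<And>k. v k \<in> controls U" "\<And>s. s \<ge> 0 \<Longrightarrow> \<forall>\<^sub>F k in sequentially. v k s = w s"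
  shows "w \<in> controls U"
proof -
  have "w s \<in> U" if "s \<ge> 0" for s
    using eventually_happens'[OF sequentially_bot assms(2)[OF that]] assms(1) that
    by (auto simp: controls_def) metis
  moreover have "w \<in> borel_measurable (lebesgue_on {0..})"
  proof (rule borel_measurable_LIMSEQ_metric)
    show "v k \<in> borel_measurable (lebesgue_on {0..})" for k
      using assms(1) by (simp add: controls_def)
    show "(\<lambda>k. v k s) \<longlonglongrightarrow> w s" if "s \<in> space (lebesgue_on {0..})" for s
      using assms(2)[of s] that by (intro tendsto_eventually) auto
  qed
  ultimately show ?thesis by (auto simp: controls_def)
qed

text \<open>The library space also demands a bounded image, which is automatic on a compact
  interval.\<close>

lemma mspace_history_space_iff: "x \<in> mspace (history_space \<tau>) \<longleftrightarrow> x \<in> extensional {-\<tau>..0} \<and> continuous_on {-\<tau>..0} x"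
proof -
  have "compactin (top_of_set {-\<tau>..0}) (topspace (top_of_set {-\<tau>..0}))"
    by (simp add: compactin_subtopology)
  then show ?thesis
    unfolding history_space_def by (subst compactin_mspace_cfunspace) auto
qed

lemma mspace_Lip_space_iff: "x \<in> mspace (Lip_space N \<tau>) \<longleftrightarrow> x \<in> extensional {-\<tau>..0} \<and> N-lipschitz_on {-\<tau>..0} x"
  using lipschitz_on_continuous_on by (auto simp: Lip_space_def mspace_history_space_iff)

lemma norm_diff_le_mdist_Lip_space:
  assumes "x \<in> mspace (Lip_space N \<tau>)" "x' \<in> mspace (Lip_space N \<tau>)" "s \<in> {-\<tau>..0}"
  shows "norm (x s - x' s) \<le> mdist (Lip_space N \<tau>) x x'"
  using mdist_cfunspace_imp_mdist_le[of x "top_of_set {-\<tau>..0}" euclidean_metric x' _ s] assms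
  by (simp add: Lip_space_def history_space_def dist_norm)

section \<open>Delayed systems\<close>

locale delay_system =
  fixes f :: "'a::euclidean_space \<Rightarrow> 'b::euclidean_space \<Rightarrow> 'a" and U :: "'b set"
    and \<tau> M L :: real
  assumes tau_pos: "\<tau> > 0" and M_pos: "M > 0" and L_pos: "L > 0"
    and f_cont: "continuous_on (UNIV \<times> U) (\<lambda>(z, u). f z u)"
    and f_bound: "\<And>z u. u \<in> U \<Longrightarrow> norm (f z u) \<le> M"
    and f_lip: "\<And>z y u. u \<in> U \<Longrightarrow> norm (f z u - f y u) \<le> L * norm (z - y)"
begin

section \<open>Construction of the flow one delay interval at a time\<close>

lemma rhs_integrable:
  assumes y: "continuous_on UNIV y" and u: "u \<in> controls U" and "a \<ge> 0"
  shows "(\<lambda>s. f (y (s - \<tau>)) (u s)) integrable_on {a..b}"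
proof (rule measurable_bounded_by_integrable_imp_integrable)
  have um: "u \<in> borel_measurable (lebesgue_on {a..b})" and uU: "u s \<in> U" if "s \<in> {a..b}" for s
  proof -
    have "u \<in> borel_measurable (restrict_space (lebesgue_on {0..}) {a..b})"
      using u by (auto simp: controls_def intro: measurable_restrict_space1)
    moreover have "restrict_space (lebesgue_on {0..}) {a..b} = lebesgue_on {a..b}"
      using \<open>a \<ge> 0\<close> by (subst restrict_restrict_space) (auto intro!: arg_cong[where f="lebesgue_on"])
    ultimately show "u \<in> borel_measurable (lebesgue_on {a..b})" by simp
  qed (use u \<open>a \<ge> 0\<close> that in \<open>auto simp: controls_def\<close>)
  show "(\<lambda>s. f (y (s - \<tau>)) (u s)) \<in> borel_measurable (lebesgue_on {a..b})"
  proof (cases "a \<le> b")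
    case True
    have "(\<lambda>s. y (s - \<tau>)) \<in> borel_measurable (lebesgue_on {a..b})"
      by (intro continuous_imp_measurable_on_sets_lebesgue continuous_intros continuous_on_compose2[OF y]) auto
    moreover have "u \<in> borel_measurable (lebesgue_on {a..b})" using um[of a] True by simp
    \<comment> \<open>Continuity of \<open>f\<close> is given on \<open>UNIV \<times> U\<close>, so
      the pair is made measurable into the Borel space restricted to that set.\<close>
    ultimately have pair: "(\<lambda>s. (y (s - \<tau>), u s)) \<in> lebesgue_on {a..b} \<rightarrow>\<^sub>M restrict_space borel (UNIV \<times> U)"
      using uU by (intro measurable_restrict_space2) (auto intro: borel_measurable_Pair)
    have "(\<lambda>(z, u). f z u) \<in> borel_measurable (restrict_space borel (UNIV \<times> U))"
      using f_cont by (rule borel_measurable_continuous_on_restrict)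
    from measurable_compose[OF pair this] show ?thesis by simp
  next
    case False
    then have "space (lebesgue_on {a..b}) = {}" by simp
    then show ?thesis by (simp add: measurable_def)
  qed
  show "norm (f (y (s - \<tau>)) (u s)) \<le> M" if "s \<in> {a..b}" for s
    using u \<open>a \<ge> 0\<close> that by (intro f_bound) (auto simp: controls_def)
qed auto

text \<open>The Picard iterates of the integral equation; the \<open>k\<close>-th one is already exact up to time
  \<open>k\<tau>\<close>. The initial datum is continued to the left of \<open>-\<tau>\<close> by a constant, and the integral
  vanishes for \<open>t \<le> 0\<close>.\<close>

primrec picard :: "(real \<Rightarrow> 'a) \<Rightarrow> (real \<Rightarrow> 'b) \<Rightarrow> nat \<Rightarrow> real \<Rightarrow> 'a" where
  "picard x u 0 = (\<lambda>t. x (max (-\<tau>) (min 0 t)))"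
| "picard x u (Suc k) = (\<lambda>t. x (max (-\<tau>) (min 0 t)) +
     integral {0..t} (\<lambda>s. f (picard x u k (s - \<tau>)) (u s)))"

text \<open>The index is the least natural \<open>k\<close> with \<open>t \<le> k * \<tau>\<close>,
  from which on the iterates no longer change at \<open>t\<close>; for \<open>t \<le> 0\<close> it
  is 0.\<close>

definition flow :: "(real \<Rightarrow> 'a) \<Rightarrow> (real \<Rightarrow> 'b) \<Rightarrow> real \<Rightarrow> 'a" where
  "flow x u t = picard x u (nat \<lceil>t / \<tau>\<rceil>) t"

text \<open>The delay shifts arguments left by \<open>\<tau>\<close>, so each integration extends
  the range of agreement by one delay. At the start the integral runs over an empty or one-point
  interval.\<close>

lemma picard_Suc_eq: "t \<le> real k * \<tau> \<Longrightarrow> picard x u (Suc k) t = picard x u k t"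
proof (induction k arbitrary: t)
  case 0
  then have "{0..t} = {} \<or> {0..t} = {0}" by auto
  then show ?case by auto
next
  case (Suc k)
  have "picard x u (Suc k) (s - \<tau>) = picard x u k (s - \<tau>)" if "s \<le> t" for s
    using Suc.prems that by (intro Suc.IH) (simp add: algebra_simps)
  then have "integral {0..t} (\<lambda>s. f (picard x u (Suc k) (s - \<tau>)) (u s)) =
      integral {0..t} (\<lambda>s. f (picard x u k (s - \<tau>)) (u s))"
    by (intro integral_cong) (simp del: picard.simps)
  then show ?case
    unfolding picard.simps(2)[of x u "Suc k"] picard.simps(2)[of x u k] by simp
qed

lemma picard_eq: "t \<le> real k * \<tau> \<Longrightarrow> picard x u (k + j) t = picard x u k t"
proof (induction j)
  case (Suc j)
  have "t \<le> real (k + j) * \<tau>"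
    using Suc.prems tau_pos by (auto intro: order_trans simp: distrib_right)
  then show ?case using picard_Suc_eq Suc by simp
qed simp

text \<open>Lets a single iterate represent the flow on a whole half-line, although its definition
  changes the index with time.\<close>

lemma flow_eq_picard:
  assumes "t \<le> real k * \<tau>"
  shows "flow x u t = picard x u k t"
proof -
  have "t / \<tau> \<le> real k"
    using assms tau_pos by (simp add: divide_le_eq)
  then have "nat \<lceil>t / \<tau>\<rceil> \<le> k" by (simp add: ceiling_le_iff nat_le_iff)
  moreover have "t \<le> real (nat \<lceil>t / \<tau>\<rceil>) * \<tau>"
    using tau_pos real_nat_ceiling_ge[of "t / \<tau>"] by (simp add: divide_le_eq)
  ultimately show ?thesis
    unfolding flow_def by (metis picard_eq le_add_diff_inverse)
qed

lemma exists_nat_mult_delay_ge: "\<exists>k. t \<le> real k * \<tau>"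
  using tau_pos reals_Archimedean3 less_imp_le by blast

lemma flow_integral_eq:
  "flow x u t = x (max (-\<tau>) (min 0 t)) + integral {0..t} (\<lambda>s. f (flow x u (s - \<tau>)) (u s))"
proof -
  obtain k where k: "t \<le> real k * \<tau>" using exists_nat_mult_delay_ge by blast
  have "picard x u k (s - \<tau>) = flow x u (s - \<tau>)" if "s \<le> t" for s
    using k that tau_pos by (intro flow_eq_picard[symmetric]) auto
  then have "integral {0..t} (\<lambda>s. f (picard x u k (s - \<tau>)) (u s)) = integral {0..t} (\<lambda>s. f (flow x u (s - \<tau>)) (u s))"
    by (intro integral_cong) simp
  moreover have "flow x u t = picard x u (Suc k) t"
    using k tau_pos by (intro flow_eq_picard) (simp add: algebra_simps)
  ultimately show ?thesis by simp
qed

lemma flow_initial: "t \<in> {-\<tau>..0} \<Longrightarrow> flow x u t = x t"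
proof -
  assume t: "t \<in> {-\<tau>..0}"
  then have "max (-\<tau>) (min 0 t) = t" by auto
  then show ?thesis using t flow_eq_picard[of t 0 x u] by simp
qed

section \<open>Regularity, existence and uniqueness of solutions\<close>

context
  fixes x :: "real \<Rightarrow> 'a" and u :: "real \<Rightarrow> 'b"
  assumes x: "continuous_on {-\<tau>..0} x" and u: "u \<in> controls U"
begin

lemma u_in: "s \<ge> 0 \<Longrightarrow> u s \<in> U"
  using u by (simp add: controls_def)

lemma continuous_on_clamp: "continuous_on UNIV (\<lambda>t. x (max (-\<tau>) (min 0 t)))"
  using tau_pos by (intro continuous_on_compose2[OF x] continuous_intros) auto

lemma continuous_on_picard: "continuous_on UNIV (picard x u k)"
proof (induction k)
  case 0
  show ?case using continuous_on_clamp by simp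
next
  case (Suc k)
  have "M-lipschitz_on UNIV (\<lambda>t. integral {0..t} (\<lambda>s. f (picard x u k (s - \<tau>)) (u s)))"
    using Suc u by (intro lipschitz_on_indefinite_integral rhs_integrable f_bound u_in) auto
  then show ?case
    unfolding picard.simps
    by (intro continuous_on_add continuous_on_clamp lipschitz_on_continuous_on)
qed

lemma continuous_on_flow: "continuous_on UNIV (flow x u)"
proof (rule continuous_at_imp_continuous_on, rule ballI)
  fix t :: real
  \<comment> \<open>On a neighbourhood of \<open>t\<close> the flow is one fixed iterate, whose
    continuity it inherits.\<close>
  obtain k where k: "t + 1 \<le> real k * \<tau>" using exists_nat_mult_delay_ge by blast
  have "continuous_on {..<t + 1} (picard x u k)"
    using continuous_on_picard continuous_on_subset by blast
  then have "continuous_on {..<t + 1} (flow x u)"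
    by (rule continuous_on_eq) (use k in \<open>auto intro!: flow_eq_picard[symmetric]\<close>)
  then show "isCont (flow x u) t"
    by (simp add: continuous_on_eq_continuous_at)
qed

lemma flow_rhs_integrable: "a \<ge> 0 \<Longrightarrow> (\<lambda>s. f (flow x u (s - \<tau>)) (u s)) integrable_on {a..b}"
  using continuous_on_flow u by (rule rhs_integrable)

lemma flow_increment:
  assumes "0 \<le> s" "s \<le> t"
  shows "flow x u t = flow x u s + integral {s..t} (\<lambda>r. f (flow x u (r - \<tau>)) (u r))"
proof -
  let ?g = "\<lambda>r. f (flow x u (r - \<tau>)) (u r)"
  have "integral {0..s} ?g + integral {s..t} ?g = integral {0..t} ?g"
    using assms by (intro Henstock_Kurzweil_Integration.integral_combine flow_rhs_integrable) auto
  then show ?thesis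
    using flow_integral_eq[of x u t] flow_integral_eq[of x u s] assms tau_pos
    by (simp add: min_def algebra_simps)
qed

lemma lipschitz_on_flow_nonneg: "M-lipschitz_on {0..} (flow x u)"
proof -
  have "M-lipschitz_on UNIV (\<lambda>t. integral {0..t} (\<lambda>s. f (flow x u (s - \<tau>)) (u s)))"
    by (intro lipschitz_on_indefinite_integral flow_rhs_integrable f_bound u_in) auto
  then have "dist (flow x u s) (flow x u t) \<le> M * dist s t" if "s \<ge> 0" "t \<ge> 0" for s t
    using flow_integral_eq[of x u s] flow_integral_eq[of x u t] that tau_pos
      lipschitz_onD[of M UNIV _ s t] by (simp add: min_def)
  then show ?thesis using M_pos by (auto intro: lipschitz_onI)
qed

text \<open>The datum has constant \<open>N\<close> before time 0 and the speed is at most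
  \<open>M \<le> N\<close> afterwards; the two pieces are glued by the triangle inequality through
  time 0.\<close>

lemma lipschitz_on_flow:
  assumes "N-lipschitz_on {-\<tau>..0} x" "M \<le> N"
  shows "N-lipschitz_on {-\<tau>..} (flow x u)"
proof (rule lipschitz_onI)
  have N: "0 \<le> N" using assms M_pos by simp
  then show "0 \<le> N" .
  have 1: "dist (flow x u s) (flow x u t) \<le> N * (t - s)" if "0 \<le> s" "s \<le> t" for s t
  proof -
    have "dist (flow x u s) (flow x u t) \<le> M * dist s t"
      using that by (intro lipschitz_onD[OF lipschitz_on_flow_nonneg]) auto
    also have "\<dots> \<le> N * (t - s)"
      using that assms by (auto simp: dist_real_def intro: mult_right_mono)
    finally show ?thesis .
  qed
  have 2: "dist (flow x u s) (flow x u t) \<le> N * (t - s)" if "-\<tau> \<le> s" "s \<le> t" "t \<le> 0" for s t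
    using lipschitz_onD[OF assms(1), of s t] that by (simp add: flow_initial dist_real_def)
  have 3: "dist (flow x u s) (flow x u t) \<le> N * (t - s)" if "-\<tau> \<le> s" "s \<le> t" for s t
  proof (cases "s < 0 \<and> t > 0")
    case True
    then have "dist (flow x u s) (flow x u t) \<le> N * (0 - s) + N * (t - 0)"
      using 1[of 0 t] 2[of s 0] that tau_pos dist_triangle[of "flow x u s" "flow x u t" "flow x u 0"] by simp
    then show ?thesis by (simp add: algebra_simps)
  qed (use 1[of s t] 2[of s t] that in auto)
  fix s t assume "s \<in> {-\<tau>..}" "t \<in> {-\<tau>..}"
  then show "dist (flow x u s) (flow x u t) \<le> N * dist s t"
    using 3[of s t] 3[of t s] by (cases "s \<le> t") (auto simp: dist_commute dist_real_def)
qed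

text \<open>The Lipschitz bound yields absolute continuity, and Lebesgue differentiation of the
  integral equation yields the differential equation almost everywhere.\<close>

lemma flow_is_solution: "is_solution \<tau> f x u (restrict (flow x u) {-\<tau>..})"
  unfolding is_solution_def
proof (intro conjI ballI allI impI)
  let ?y = "restrict (flow x u) {-\<tau>..}" and ?g = "\<lambda>s. f (flow x u (s - \<tau>)) (u s)"
  show "?y \<in> extensional {-\<tau>..}" by simp
  show "?y s = x s" if "s \<in> {-\<tau>..0}" for s
    using that by (simp add: flow_initial)
  show "abs_continuous_on {0..b} ?y" if "b \<ge> 0" for b
  proof (rule lipschitz_on_imp_abs_continuous_on)
    have "M-lipschitz_on {0..b} (flow x u)"
      using lipschitz_on_flow_nonneg by (rule lipschitz_on_subset) auto
    then show "M-lipschitz_on {0..b} ?y"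
      using tau_pos by (elim lipschitz_on_transform) auto
  qed
  \<comment> \<open>Differentiation is available on bounded intervals, so the half-line is exhausted
    by countably many of them.\<close>
  define B where "B n = {t \<in> {0<..<real n}. \<not> ((\<lambda>t. integral {0..t} ?g) has_vector_derivative ?g t) (at t)}" for n
  have "negligible (B n)" for n
    unfolding B_def
    by (rule negligible_not_has_vector_derivative_indefinite_integral[OF flow_rhs_integrable]) simp
  \<comment> \<open>Time 0 is excluded as well: the derivative is two-sided and would there involve
    the initial datum.\<close>
  then have neg: "negligible (insert 0 (\<Union>n. B n))"
    unfolding negligible_insert by (intro negligible_countable_Union) auto
  have "(?y has_vector_derivative f (?y (t - \<tau>)) (u t)) (at t)" if t: "t \<ge> 0" "t \<notin> insert 0 (\<Union>n. B n)" for t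
  proof -
    have "t > 0" using t by auto
    obtain n where "t < real n" using reals_Archimedean2 by blast
    with t \<open>t > 0\<close> have "((\<lambda>t. integral {0..t} ?g) has_vector_derivative ?g t) (at t)"
      by (auto simp: B_def)
    then have "((\<lambda>t. x 0 + integral {0..t} ?g) has_vector_derivative ?g t) (at t)"
      by (rule has_vector_derivative_add_const[THEN iffD2, of "\<lambda>t. integral {0..t} ?g" _ _ "x 0", unfolded add.commute[of _ "x 0"]])
    then have "(?y has_vector_derivative ?g t) (at t)"
    proof (rule has_vector_derivative_transform_within_open[of _ _ _ "{0<..}"])
      show "x 0 + integral {0..s} ?g = ?y s" if "s \<in> {0<..}" for s
        using that tau_pos flow_integral_eq[of x u s] by simp
    qed (use \<open>t > 0\<close> in auto)
    then show ?thesis using \<open>t > 0\<close> by simp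
  qed
  then have "AE t in lebesgue. t \<in> {0..} \<longrightarrow> (?y has_vector_derivative f (?y (t - \<tau>)) (u t)) (at t)"
    unfolding eventually_ae_filter_negligible
    by (intro exI[of _ "insert 0 (\<Union>n. B n)"] conjI neg) auto
  then show "AE t in lebesgue_on {0..}. (?y has_vector_derivative f (?y (t - \<tau>)) (u t)) (at t)"
    by (simp add: AE_restrict_space_iff)
qed

end

text \<open>If two solutions agree up to \<open>k * \<tau>\<close>, their delayed arguments agree
  for one more delay, so their difference has derivative zero almost everywhere and, being
  absolutely continuous, is constant.\<close>

lemma is_solution_unique:
  assumes "is_solution \<tau> f x u y" "is_solution \<tau> f x u z"
  shows "y = z"
proof -
  have eq: "\<forall>t. -\<tau> \<le> t \<and> t \<le> real k * \<tau> \<longrightarrow> y t = z t" for k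
  proof (induction k)
    case 0
    then show ?case using assms by (auto simp: is_solution_def)
  next
    case (Suc k)
    show ?case
    proof (intro allI impI)
      fix t assume t: "-\<tau> \<le> t \<and> t \<le> real (Suc k) * \<tau>"
      show "y t = z t"
      proof (cases "t \<le> 0")
        case True
        then show ?thesis using assms t by (auto simp: is_solution_def)
      next
        case False
        have "AE r in lebesgue_on {0..}. (y has_vector_derivative f (y (r - \<tau>)) (u r)) (at r) \<and>
            (z has_vector_derivative f (z (r - \<tau>)) (u r)) (at r)"
          using assms unfolding is_solution_def by (intro AE_conjI) blast+
        then have "AE r in lebesgue. r \<in> {0..} \<longrightarrow> (y has_vector_derivative f (y (r - \<tau>)) (u r)) (at r) \<and>
            (z has_vector_derivative f (z (r - \<tau>)) (u r)) (at r)"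
          by (subst (asm) AE_restrict_space_iff) auto
        then obtain E where "negligible E" and E: "\<And>r. r \<ge> 0 \<Longrightarrow> r \<notin> E \<Longrightarrow>
            (y has_vector_derivative f (y (r - \<tau>)) (u r)) (at r) \<and>
            (z has_vector_derivative f (z (r - \<tau>)) (u r)) (at r)"
          unfolding eventually_ae_filter_negligible by auto
        have "y t - z t = y 0 - z 0"
        proof (rule abs_continuous_on_zero_derivative_eq[of 0 t "\<lambda>r. y r - z r" E])
          show "abs_continuous_on {0..t} (\<lambda>r. y r - z r)"
            using assms False by (intro abs_continuous_on_diff) (auto simp: is_solution_def)
          fix r assume r: "r \<in> {0..t} - E"
          have "y (r - \<tau>) = z (r - \<tau>)"
            using Suc r t by (auto simp: algebra_simps)
          moreover have "((\<lambda>r. y r - z r) has_vector_derivative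
              f (y (r - \<tau>)) (u r) - f (z (r - \<tau>)) (u r)) (at r)"
            using E[of r] r by (intro has_vector_derivative_diff) auto
          ultimately show "((\<lambda>r. y r - z r) has_vector_derivative 0) (at r within {0..t})"
            by (auto intro: has_vector_derivative_at_within)
        qed (use False \<open>negligible E\<close> in auto)
        moreover have "y 0 = z 0" using assms tau_pos by (auto simp: is_solution_def)
        ultimately show ?thesis by simp
      qed
    qed
  qed
  show ?thesis
  proof
    fix t
    show "y t = z t"
    proof (cases "t \<ge> -\<tau>")
      case True
      then show ?thesis using eq exists_nat_mult_delay_ge by blast
    next
      case False
      then show ?thesis using assms by (auto simp: is_solution_def extensional_def)
    qed
  qed
qed

text \<open>Existence and uniqueness resolve the definite description, so hitting times can be
  studied on the explicit flow.\<close>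

lemma trajectory_eq_flow:
  assumes "continuous_on {-\<tau>..0} x" "u \<in> controls U" "t \<ge> -\<tau>"
  shows "trajectory \<tau> f x u t = flow x u t"
proof -
  have "trajectory \<tau> f x u = restrict (flow x u) {-\<tau>..}"
    unfolding trajectory_def
    using flow_is_solution[OF assms(1,2)] is_solution_unique by (intro the_equality) auto
  then show ?thesis using assms by simp
qed

section \<open>Dependence on the control and on the initial datum\<close>

lemma flow_causal:
  assumes "\<And>s. 0 \<le> s \<Longrightarrow> s < t \<Longrightarrow> u s = v s" "r \<le> t"
  shows "flow x u r = flow x v r"
proof -
  have "picard x u k r = picard x v k r" if "r \<le> t" for k r
    using that
  proof (induction k arbitrary: r)
    case (Suc k)
    \<comment> \<open>The controls are known to agree only before \<open>t\<close>; if
      \<open>r = t\<close> the endpoint is discarded as a null set. Hence switching at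
      \<open>t\<close> preserves the state at \<open>t\<close> itself.\<close>
    have "integral {0..r} (\<lambda>s. f (picard x u k (s - \<tau>)) (u s)) =
        integral {0..r} (\<lambda>s. f (picard x v k (s - \<tau>)) (v s))"
      using Suc assms(1) tau_pos by (intro integral_spike[of "{r}"]) auto
    then show ?case by simp
  qed simp
  then show ?thesis using assms(2) by (simp add: flow_def)
qed

text \<open>Gronwall by delay intervals: the error at the start of an interval is at most
  \<open>c\<close>, and the integrand, which sees only earlier states, adds at most
  \<open>L * c\<close> per unit of time. Each interval thus costs a factor
  \<open>1 + L * \<tau>\<close>.\<close>

lemma flow_dependence:
  assumes x: "continuous_on {-\<tau>..0} x" and x': "continuous_on {-\<tau>..0} x'" and u: "u \<in> controls U"
    and e: "\<And>s. s \<in> {-\<tau>..0} \<Longrightarrow> norm (x s - x' s) \<le> e"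
    and "-\<tau> \<le> t" "t \<le> real k * \<tau>"
  shows "norm (flow x u t - flow x' u t) \<le> (1 + L * \<tau>) ^ k * e"
  using \<open>-\<tau> \<le> t\<close> \<open>t \<le> real k * \<tau>\<close>
proof (induction k arbitrary: t)
  case 0
  then show ?case using e by (simp add: flow_initial)
next
  case (Suc k)
  let ?c = "(1 + L * \<tau>) ^ k * e"
  have c: "?c \<ge> 0"
    using order_trans[OF norm_ge_zero e[of 0]] tau_pos L_pos by (intro mult_nonneg_nonneg zero_le_power) auto
  have Suc_eq: "(1 + L * \<tau>) ^ Suc k * e = ?c + L * ?c * \<tau>" by (simp add: algebra_simps)
  show ?case
  proof (cases "t \<le> real k * \<tau>")
    case True
    then show ?thesis
      using Suc.IH[of t] Suc.prems c tau_pos L_pos unfolding Suc_eq by (smt (verit) mult_nonneg_nonneg)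
  next
    case False
    let ?s = "real k * \<tau>"
    let ?g = "\<lambda>x r. f (flow x u (r - \<tau>)) (u r)"
    have s: "0 \<le> ?s" "?s \<le> t" "t - ?s \<le> \<tau>" using False tau_pos Suc.prems by (auto simp: algebra_simps)
    have int: "?g x integrable_on {?s..t}" "?g x' integrable_on {?s..t}"
      using flow_rhs_integrable x x' u s by auto
    have "norm (integral {?s..t} (\<lambda>r. ?g x r - ?g x' r)) \<le> (L * ?c) * (t - ?s)"
    proof (rule norm_integral_le_const)
      fix r assume r: "r \<in> {?s..t}"
      have "norm (?g x r - ?g x' r) \<le> L * norm (flow x u (r - \<tau>) - flow x' u (r - \<tau>))"
        using order_trans[OF s(1), of r] r by (intro f_lip u_in[OF x u]) auto
      also have "\<dots> \<le> L * ?c"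
      proof -
        have "0 \<le> r" using order_trans[OF s(1), of r] r by simp
        then show ?thesis
          using r Suc.prems L_pos tau_pos by (intro mult_left_mono Suc.IH) (auto simp: algebra_simps)
      qed
      finally show "norm (?g x r - ?g x' r) \<le> L * ?c" .
    qed (use int s in \<open>auto intro: integrable_diff\<close>)
    also have "\<dots> \<le> (L * ?c) * \<tau>" using s c L_pos by (intro mult_left_mono) auto
    finally have 1: "norm (integral {?s..t} (?g x) - integral {?s..t} (?g x')) \<le> L * ?c * \<tau>"
      using integral_diff[OF int] by simp
    have 2: "norm (flow x u ?s - flow x' u ?s) \<le> ?c"
    proof (rule Suc.IH)
      show "- \<tau> \<le> ?s" using s(1) tau_pos by linarith
    qed simp
    have "flow x u t - flow x' u t = (flow x u ?s - flow x' u ?s) + (integral {?s..t} (?g x) - integral {?s..t} (?g x'))"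
      using flow_increment[OF x u s(1,2)] flow_increment[OF x' u s(1,2)] by simp
    then show ?thesis
      using norm_triangle_ineq[of "flow x u ?s - flow x' u ?s" "integral {?s..t} (?g x) - integral {?s..t} (?g x')"] 1 2
      unfolding Suc_eq by simp
  qed
qed

end

section \<open>Reaching the target\<close>

text \<open>\<open>N\<close> bounds the Lipschitz constants of data and trajectories alike. The
  delay bound is in the form that makes \<open>\<mu> - L * N * \<tau>\<close> positive.\<close>

locale controlled_delay_system = delay_system f U \<tau> M L
  for f :: "'a::euclidean_space \<Rightarrow> 'b::euclidean_space \<Rightarrow> 'a" and U :: "'b set" and \<tau> M L :: real +
  fixes K :: "'a set" and \<mu> \<sigma> N :: real
  assumes K_nonempty: "K \<noteq> {}" and closed_K: "closed K"
    and sigma_pos: "\<sigma> > 0"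
    and descent: "\<And>x. x \<in> {z. infdist z K < \<sigma>} - K \<Longrightarrow>
           \<exists>u\<in>U. \<exists>p\<in>K. infdist x K = norm (x - p) \<and>
             f x u \<bullet> ((x - p) /\<^sub>R norm (x - p)) \<le> - \<mu>"
    and M_le_N: "M \<le> N"
    and small_delay: "\<tau> < \<mu> / (N * L)"
begin

text \<open>Descent rate surviving the delay. The cap at \<open>M\<close> keeps
  \<open>contraction\<close> positive.\<close>

definition rate :: real where "rate = min (\<mu> - L * N * \<tau>) M"
text \<open>Upper bound for \<open>sqrt (1 - rate\<^sup>2 / M\<^sup>2)\<close>, the factor gained by
  a step of optimal length.\<close>

definition contraction :: real where "contraction = 1 - rate\<^sup>2 / (2 * M\<^sup>2)"
text \<open>\<open>\<sigma>\<close> gives access to the descent hypothesis; the other bound makes a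
  step of length \<open>d * rate / M\<^sup>2\<close> last at most \<open>2 * \<tau>\<close>.\<close>

definition radius :: real where "radius = min \<sigma> (2 * \<tau> * M\<^sup>2 / rate)"
text \<open>Sum of the geometric series of step lengths per unit of initial distance; it equals
  \<open>2 / rate\<close>.\<close>

definition time_const :: real where "time_const = rate / M\<^sup>2 / (1 - contraction)"

lemma rate_pos: "rate > 0" and rate_le: "rate \<le> M" "rate \<le> \<mu> - L * N * \<tau>"
proof -
  have "N * L > 0" using M_le_N M_pos L_pos by simp
  then have "\<tau> * (N * L) < \<mu>" using small_delay by (simp add: pos_less_divide_eq)
  then show "rate > 0" using M_pos by (simp add: rate_def algebra_simps)
qed (auto simp: rate_def)

lemma contraction_bounds: "0 < contraction" "contraction < 1"
proof -
  have "rate\<^sup>2 \<le> M\<^sup>2" using rate_pos rate_le by (intro power_mono) auto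
  moreover have pos: "rate\<^sup>2 > 0" "M\<^sup>2 > 0" using rate_pos M_pos by auto
  ultimately have "rate\<^sup>2 < 2 * M\<^sup>2" by linarith
  with pos show "0 < contraction" "contraction < 1"
    by (simp_all add: contraction_def divide_less_eq)
qed

lemma radius_pos: "radius > 0"
  using sigma_pos tau_pos M_pos rate_pos by (simp add: radius_def)

lemma time_const_nonneg: "time_const \<ge> 0"
  using rate_pos contraction_bounds by (simp add: time_const_def)

text \<open>Clearing the denominator covers states already in \<open>K\<close>, with
  \<open>p = z\<close> and both sides zero.\<close>

lemma exists_descent_direction:
  assumes "infdist z K < radius" "U \<noteq> {}"
  shows "\<exists>c\<in>U. \<exists>p\<in>K. infdist z K = norm (z - p) \<and> f z c \<bullet> (z - p) \<le> - \<mu> * norm (z - p)"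
proof (cases "z \<in> K")
  case True
  then show ?thesis using assms(2) by (auto intro!: bexI[of _ z])
next
  case False
  with assms descent[of z] obtain c p where cp: "c \<in> U" "p \<in> K" "infdist z K = norm (z - p)"
    "f z c \<bullet> ((z - p) /\<^sub>R norm (z - p)) \<le> - \<mu>"
    by (auto simp: radius_def)
  have "norm (z - p) > 0" using False cp(2) by auto
  moreover have "inverse (norm (z - p)) * (f z c \<bullet> (z - p)) \<le> - \<mu>"
    using cp(4) by (simp only: inner_scaleR_right)
  ultimately have "f z c \<bullet> (z - p) \<le> - \<mu> * norm (z - p)"
    by (simp only: divide_inverse_commute[symmetric] pos_divide_le_eq)
  with cp show ?thesis by blast
qed

section \<open>Steering a trajectory into the target\<close>

context
  fixes x :: "real \<Rightarrow> 'a"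
  assumes x_lip: "N-lipschitz_on {-\<tau>..0} x"
begin

lemma x_cont: "continuous_on {-\<tau>..0} x"
  using x_lip by (rule lipschitz_on_continuous_on)

text \<open>Steering with the value chosen at \<open>z = y(t)\<close> for a time proportional to the distance: the
  delayed state stays within \<open>N\<tau>\<close> of \<open>z\<close>, so the descent rate drops from \<open>\<mu>\<close> to no less than
  \<open>\<mu> - LN\<tau>\<close>. The bound on the radius keeps the step below \<open>2\<tau>\<close>.\<close>

lemma contraction_step:
  assumes u: "u \<in> controls U" and t: "t \<ge> 0" and near: "infdist (flow x u t) K < radius"
  obtains v where "v \<in> controls U" "\<And>s. s < t \<Longrightarrow> v s = u s"
    "infdist (flow x v (t + infdist (flow x u t) K * (rate / M\<^sup>2))) K
       \<le> contraction * infdist (flow x u t) K"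
proof -
  define z where "z = flow x u t"
  define d where "d = infdist z K"
  define h where "h = d * (rate / M\<^sup>2)"
  have "U \<noteq> {}" using u by (auto simp: controls_def)
  then obtain c p where c: "c \<in> U" and p: "p \<in> K" "d = norm (z - p)"
    and desc: "f z c \<bullet> (z - p) \<le> - \<mu> * d"
    using exists_descent_direction[of z] near by (auto simp: z_def d_def)
  define v where "v s = (if s < t then u s else c)" for s
  have v: "v \<in> controls U"
    unfolding v_def[abs_def] using u c by (intro controls_If controls_const)
  have vz: "flow x v t = z"
    unfolding z_def by (rule flow_causal) (auto simp: v_def)
  have d: "0 \<le> d" by (simp add: d_def infdist_nonneg)
  have h: "0 \<le> h" "h \<le> 2 * \<tau>"
  proof -
    show "0 \<le> h" using d rate_pos by (simp add: h_def)
    have "d \<le> 2 * \<tau> * M\<^sup>2 / rate" using near by (simp add: z_def d_def radius_def)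
    then show "h \<le> 2 * \<tau>" using rate_pos M_pos by (simp add: h_def field_simps)
  qed
  let ?g = "\<lambda>r. f (flow x v (r - \<tau>)) (v r)"
  define I where "I = integral {t..t + h} ?g"
  have int: "?g integrable_on {t..t + h}"
    using t by (intro flow_rhs_integrable x_cont v)
  have end_eq: "flow x v (t + h) = z + I"
    unfolding I_def vz[symmetric] using t h by (intro flow_increment x_cont v) auto
  have "?g r \<bullet> (z - p) \<le> - rate * d" if r: "r \<in> {t..t + h}" for r
  proof -
    have "norm (flow x v (r - \<tau>) - flow x v t) \<le> N * \<bar>r - \<tau> - t\<bar>"
      using lipschitz_onD[OF lipschitz_on_flow[OF x_cont v x_lip M_le_N], of "r - \<tau>" t] r t tau_pos
      by (simp add: dist_norm dist_real_def)
    \<comment> \<open>Since \<open>0 \<le> r - t \<le> 2 * \<tau>\<close>, the delayed time differs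
      from \<open>t\<close> by at most \<open>\<tau>\<close>, on either side.\<close>
    also have "\<dots> \<le> N * \<tau>"
      using r h M_le_N M_pos by (intro mult_left_mono) auto
    finally have "L * norm (flow x v (r - \<tau>) - z) \<le> L * (N * \<tau>)"
      using L_pos by (simp add: vz)
    then have "norm (?g r - f z c) \<le> L * (N * \<tau>)"
      using f_lip[OF c, of "flow x v (r - \<tau>)" z] r by (simp add: v_def)
    then have "(?g r - f z c) \<bullet> (z - p) \<le> L * (N * \<tau>) * d"
      unfolding p(2)
      by (intro order_trans[OF norm_cauchy_schwarz] mult_right_mono norm_ge_zero)
    then have "?g r \<bullet> (z - p) \<le> - (\<mu> - L * N * \<tau>) * d"
      using desc by (simp add: inner_diff_left algebra_simps)
    also have "\<dots> \<le> - rate * d"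
      using rate_le d by (intro mult_right_mono) auto
    finally show ?thesis .
  qed
  then have "integral {t..t + h} (\<lambda>r. ?g r \<bullet> (z - p)) \<le> integral {t..t + h} (\<lambda>r. - rate * d)"
    using integrable_linear[OF int bounded_linear_inner_left[of "z - p"]]
    by (intro integral_le) (auto simp: o_def)
  then have inner: "I \<bullet> (z - p) \<le> - rate * d * h"
    using h integral_linear[OF int bounded_linear_inner_left[of "z - p"]] by (simp add: I_def o_def mult_ac)
  have "norm I \<le> M * (t + h - t)"
    unfolding I_def using int h t v by (intro norm_integral_le_const f_bound) (auto simp: controls_def)
  then have norm_I: "(norm I)\<^sup>2 \<le> (M * h)\<^sup>2" by (intro power_mono) auto
  \<comment> \<open>The cross term carries the descent, the quadratic one is controlled by the speed
    bound \<open>M\<close>.\<close>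
  have "(norm (z + I - p))\<^sup>2 = d\<^sup>2 + 2 * (I \<bullet> (z - p)) + (norm I)\<^sup>2"
    unfolding p(2) power2_norm_eq_inner by (simp add: inner_simps inner_commute algebra_simps)
  also have "\<dots> \<le> d\<^sup>2 - 2 * rate * d * h + (M * h)\<^sup>2"
    using inner norm_I by simp
  \<comment> \<open>The chosen \<open>h\<close> minimises this quadratic polynomial.\<close>
  also have "\<dots> = d\<^sup>2 * (1 - rate\<^sup>2 / M\<^sup>2)"
    using M_pos by (simp add: h_def field_simps power2_eq_square)
  also have "\<dots> \<le> (contraction * d)\<^sup>2"
  proof -
    \<comment> \<open>Completing the square, \<open>1 - a \<le> (1 - a / 2)\<^sup>2\<close>, avoids
      a square root.\<close>
    have "1 - rate\<^sup>2 / M\<^sup>2 \<le> contraction\<^sup>2"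
    proof -
      define a where "a = rate\<^sup>2 / M\<^sup>2"
      have "contraction = 1 - a / 2" by (simp add: contraction_def a_def)
      moreover have "1 - a \<le> (1 - a / 2)\<^sup>2" by (simp add: power2_eq_square algebra_simps)
      ultimately show ?thesis by (simp add: a_def)
    qed
    then show ?thesis
      by (simp add: power_mult_distrib mult.commute mult_left_mono)
  qed
  finally have "norm (z + I - p) \<le> contraction * d"
    by (rule power2_le_imp_le) (use contraction_bounds d in simp)
  moreover have "infdist (z + I) K \<le> norm (z + I - p)"
    using infdist_le[OF p(1), of "z + I"] by (simp add: dist_norm)
  ultimately have "infdist (flow x v (t + d * (rate / M\<^sup>2))) K \<le> contraction * d"
    unfolding h_def[symmetric] end_eq by linarith
  moreover have "v s = u s" if "s < t" for s using that by (simp add: v_def)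
  ultimately show thesis
    using v unfolding d_def z_def by (intro that[of v])
qed

text \<open>Iterating the step, the distances decay geometrically and the switching times are dominated
  by a geometric series; the concatenated control therefore reaches the target at their limit.\<close>

lemma local_reachability:
  assumes u: "u \<in> controls U" and t0: "t0 \<ge> 0" and near: "infdist (flow x u t0) K < radius"
  shows "\<exists>w\<in>controls U. \<exists>t\<ge>0. t \<le> t0 + time_const * infdist (flow x u t0) K \<and> flow x w t \<in> K"
proof -
  define D where "D tw = infdist (flow x (snd tw) (fst tw)) K" for tw :: "real \<times> (real \<Rightarrow> 'b)"
  \<comment> \<open>Stages are pairs of a switching time and a control; the clause for
    \<open>n = 0\<close> pins the first pair in the dependent choice.\<close>
  let ?P = "\<lambda>n tw. (n = (0::nat) \<longrightarrow> tw = (t0, u)) \<and> fst tw \<ge> 0 \<and> snd tw \<in> controls U \<and> D tw < radius"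
  let ?Q = "\<lambda>n tw tw'. fst tw' = fst tw + D tw * (rate / M\<^sup>2) \<and> D tw' \<le> contraction * D tw \<and>
              (\<forall>s<fst tw. snd tw' s = snd tw s)"
  have D_nonneg: "0 \<le> D tw" for tw by (simp add: D_def infdist_nonneg)
  have "\<exists>S. \<forall>n. ?P n (S n) \<and> ?Q n (S n) (S (Suc n))"
  proof (rule dependent_nat_choice)
    show "\<exists>tw. ?P 0 tw" using u t0 near by (simp add: D_def)
    fix tw and n :: nat
    assume P: "?P n tw"
    then obtain v where v: "v \<in> controls U" "\<And>s. s < fst tw \<Longrightarrow> v s = snd tw s"
      "D (fst tw + D tw * (rate / M\<^sup>2), v) \<le> contraction * D tw"
      using contraction_step[of "snd tw" "fst tw"] by (auto simp: D_def)
    have "contraction * D tw \<le> D tw"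
      using contraction_bounds D_nonneg[of tw] by (simp add: mult_left_le_one_le)
    with P v D_nonneg[of tw] rate_pos
    show "\<exists>tw'. ?P (Suc n) tw' \<and> ?Q n tw tw'"
      by (intro exI[of _ "(fst tw + D tw * (rate / M\<^sup>2), v)"]) auto
  qed
  then obtain S where S: "\<And>n. ?P n (S n)" "\<And>n. ?Q n (S n) (S (Suc n))" by blast
  define T where "T n = fst (S n)" for n
  define W where "W n = snd (S n)" for n
  define d where "d n = D (S n)" for n
  have d_eq: "d n = infdist (flow x (W n) (T n)) K" for n by (simp add: d_def D_def T_def W_def)
  have W: "W n \<in> controls U" and T_nonneg: "T n \<ge> 0" for n
    using S(1)[of n] by (auto simp: W_def T_def)
  have T_Suc: "T (Suc n) = T n + d n * (rate / M\<^sup>2)" and d_Suc: "d (Suc n) \<le> contraction * d n"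
    and W_Suc: "s < T n \<Longrightarrow> W (Suc n) s = W n s" for n s
    using S(2)[of n] by (auto simp: W_def T_def d_def)
  have T0: "T 0 = t0" "d 0 = infdist (flow x u t0) K"
    using S(1)[of 0] by (auto simp: T_def d_def D_def)
  have d_nonneg: "d n \<ge> 0" for n by (simp add: d_def D_nonneg)
  have d_le: "d n \<le> contraction ^ n * d 0" for n
  proof (induction n)
    case (Suc n)
    then have "contraction * d n \<le> contraction * (contraction ^ n * d 0)"
      using contraction_bounds by (intro mult_left_mono) auto
    with d_Suc[of n] show ?case by (simp add: mult.assoc)
  qed simp
  \<comment> \<open>The partial sum of the geometric series makes the induction close; the bare
    limit bound would not be inductive.\<close>
  have "T n \<le> t0 + time_const * d 0 * (1 - contraction ^ n)" for n
  proof (induction n)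
    case (Suc n)
    have "d n * (rate / M\<^sup>2) \<le> contraction ^ n * d 0 * (rate / M\<^sup>2)"
      using rate_pos by (intro mult_right_mono d_le) auto
    also have "\<dots> = contraction ^ n * d 0 * (time_const * (1 - contraction))"
      using contraction_bounds by (simp add: time_const_def)
    also have "\<dots> = time_const * d 0 * (1 - contraction ^ Suc n) - time_const * d 0 * (1 - contraction ^ n)"
      by (simp add: algebra_simps)
    finally show ?case using Suc unfolding T_Suc by linarith
  qed (simp add: T0)
  moreover have "time_const * d 0 * (1 - contraction ^ n) \<le> time_const * d 0" for n
    using contraction_bounds time_const_nonneg d_nonneg by (intro mult_left_le) auto
  ultimately have T_le: "T n \<le> t0 + time_const * d 0" for n
    using order_trans add_left_mono by meson
  have "T n \<le> T (Suc n)" for n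
    using d_nonneg[of n] rate_pos by (simp add: T_Suc)
  then have inc: "incseq T" by (rule incseq_SucI)
  then obtain T' where T': "T \<longlonglongrightarrow> T'" "\<And>n. T n \<le> T'"
    using incseq_convergent[OF _ allI[of "\<lambda>n. T n \<le> _", OF T_le]] by blast
  have T'_le: "T' \<le> t0 + time_const * d 0"
    using T'(1) T_le by (intro LIMSEQ_le_const2) auto
  have W_stable: "W (n + j) s = W n s" if "s < T n" for n j s
  proof (induction j)
    case (Suc j)
    have "T n \<le> T (n + j)" using incseqD[OF inc] by simp
    then show ?case using W_Suc[of s "n + j"] that Suc by simp
  qed simp
  \<comment> \<open>Before the limit time the stages stabilise and the first one reaching beyond
    \<open>s\<close> decides; from the limit time on, \<open>u\<close> is a mere default.\<close>
  define w where "w s = (if \<exists>n. s < T n then W (LEAST n. s < T n) s else u s)" for s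
  have w_eq: "w s = W n s" if "s < T n" for s n
  proof -
    have "s < T (LEAST n. s < T n)" "(LEAST n. s < T n) \<le> n"
      using that by (rule LeastI, rule Least_le)
    then show ?thesis
      using W_stable[of s "LEAST n. s < T n" "n - (LEAST n. s < T n)"] that by (auto simp: w_def)
  qed
  have w: "w \<in> controls U"
  proof (rule controls_LIMSEQ)
    show "(\<lambda>s. if s < T n then W n s else u s) \<in> controls U" for n
      using W u by (rule controls_If)
    fix s :: real
    show "\<forall>\<^sub>F n in sequentially. (if s < T n then W n s else u s) = w s"
    proof (cases "\<exists>n. s < T n")
      case True
      then obtain n where "s < T n" by blast
      then have "s < T k" if "k \<ge> n" for k using incseqD[OF inc that] by simp
      then show ?thesis
        using w_eq[of s, symmetric] by (intro eventually_sequentiallyI[of n]) auto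
    next
      case False
      then show ?thesis by (simp add: w_def)
    qed
  qed
  \<comment> \<open>By causality the limit control visits the state of stage \<open>n\<close> at its
    switching time, so the decaying distances are those of one trajectory.\<close>
  have "flow x w (T n) = flow x (W n) (T n)" for n
    using w_eq by (intro flow_causal) auto
  then have "d = (\<lambda>n. infdist (flow x w (T n)) K)" by (simp add: d_eq fun_eq_iff)
  moreover have "(\<lambda>n. infdist (flow x w (T n)) K) \<longlonglongrightarrow> infdist (flow x w T') K"
    using continuous_on_flow[OF x_cont w] T'(1)
    by (intro tendsto_infdist) (auto simp: continuous_on_eq_continuous_at intro: isCont_tendsto_compose)
  moreover have "d \<longlonglongrightarrow> 0"
  proof (rule tendsto_sandwich[OF _ _ tendsto_const])
    show "(\<lambda>n. contraction ^ n * d 0) \<longlonglongrightarrow> 0"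
      using contraction_bounds by (intro tendsto_mult_left_zero LIMSEQ_realpow_zero) auto
  qed (use d_nonneg d_le in auto)
  ultimately have "infdist (flow x w T') K = 0"
    using LIMSEQ_unique by blast
  then have "flow x w T' \<in> K"
    using closed_K K_nonempty by (simp add: in_closed_iff_infdist_zero)
  moreover have "T' \<ge> 0" using T'(2)[of 0] T0 t0 by simp
  ultimately show ?thesis
    using w T'_le T0 by auto
qed

end

section \<open>Hitting times and the minimum time\<close>

lemma hitting_time_le:
  assumes "continuous_on {-\<tau>..0} x" "u \<in> controls U" "t \<ge> 0" "flow x u t \<in> K"
  shows "hitting_time \<tau> f K x u \<le> ereal t"
    and "\<exists>r\<ge>0. flow x u r \<in> K \<and> hitting_time \<tau> f K x u = ereal r"
proof -
  note traj = trajectory_eq_flow[OF assms(1,2)]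
  \<comment> \<open>\<open>LEAST\<close> on the reals is meaningful only if the minimum is attained;
    compactness of the hitting times up to \<open>t\<close> provides it.\<close>
  have "compact ({0..t} \<inter> flow x u -` K)"
    using closed_vimage[OF closed_K continuous_on_flow[OF assms(1,2)]] by (intro compact_Int_closed) auto
  moreover have "t \<in> {0..t} \<inter> flow x u -` K" using assms(3,4) by simp
  ultimately have "\<exists>r\<in>{0..t} \<inter> flow x u -` K. \<forall>s\<in>{0..t} \<inter> flow x u -` K. r \<le> s"
    by (intro continuous_attains_inf[of _ "\<lambda>s. s"]) auto
  then obtain r where r: "r \<in> {0..t} \<inter> flow x u -` K" and min: "\<And>s. s \<in> {0..t} \<inter> flow x u -` K \<Longrightarrow> r \<le> s"
    by blast
  have "(LEAST s. s \<ge> 0 \<and> trajectory \<tau> f x u s \<in> K) = r"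
  proof (rule Least_equality)
    show "0 \<le> r \<and> trajectory \<tau> f x u r \<in> K" using r traj[of r] tau_pos by auto
    show "r \<le> s" if "0 \<le> s \<and> trajectory \<tau> f x u s \<in> K" for s
      using that traj[of s] tau_pos min[of s] r by (cases "s \<le> t") auto
  qed
  moreover have "\<exists>s\<ge>0. trajectory \<tau> f x u s \<in> K"
    using assms(3,4) traj[of t] tau_pos by (intro exI[of _ t]) auto
  ultimately have "hitting_time \<tau> f K x u = ereal r" by (simp add: hitting_time_def)
  with r show "hitting_time \<tau> f K x u \<le> ereal t"
    "\<exists>r\<ge>0. flow x u r \<in> K \<and> hitting_time \<tau> f K x u = ereal r" by auto
qed

lemma hitting_time_finiteD:
  assumes "continuous_on {-\<tau>..0} x" "u \<in> controls U" "hitting_time \<tau> f K x u < \<infinity>"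
  obtains t where "t \<ge> 0" "flow x u t \<in> K" "hitting_time \<tau> f K x u = ereal t"
proof -
  obtain s where "s \<ge> 0" "trajectory \<tau> f x u s \<in> K"
    using assms(3) by (auto simp: hitting_time_def split: if_splits)
  then show thesis
    using hitting_time_le(2)[OF assms(1,2), of s] trajectory_eq_flow[OF assms(1,2), of s] tau_pos that by auto
qed

lemma hitting_time_nonneg:
  assumes "continuous_on {-\<tau>..0} x" "u \<in> controls U"
  shows "0 \<le> hitting_time \<tau> f K x u"
proof (cases "hitting_time \<tau> f K x u < \<infinity>")
  case True
  then show ?thesis by (rule hitting_time_finiteD[OF assms]) simp
qed simp

lemma min_time_le:
  assumes "continuous_on {-\<tau>..0} x" "u \<in> controls U" "t \<ge> 0" "flow x u t \<in> K"
  shows "min_time \<tau> f U K x \<le> t"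
proof -
  have "0 \<le> (INF u\<in>controls U. hitting_time \<tau> f K x u)"
    by (intro INF_greatest hitting_time_nonneg assms(1))
  moreover have "(INF u\<in>controls U. hitting_time \<tau> f K x u) \<le> ereal t"
    using hitting_time_le(1)[OF assms] by (rule INF_lower2[OF assms(2)])
  ultimately show ?thesis
    unfolding min_time_def by (cases "INF u\<in>controls U. hitting_time \<tau> f K x u") auto
qed

text \<open>The infimum over controls need not be attained, so later estimates use near-optimal
  controls and let the slack tend to zero.\<close>

lemma min_time_approx:
  assumes x: "x \<in> reachable \<tau> f U K" and "e > 0"
  obtains u t where "u \<in> controls U" "t \<ge> 0" "flow x u t \<in> K" "t < min_time \<tau> f U K x + e"
proof -
  have cont: "continuous_on {-\<tau>..0} x"
    using x by (simp add: reachable_def mspace_history_space_iff)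
  let ?V = "INF u\<in>controls U. hitting_time \<tau> f K x u"
  obtain u0 where u0: "u0 \<in> controls U" "hitting_time \<tau> f K x u0 < \<infinity>"
    using x by (auto simp: reachable_def)
  then have "?V < \<infinity>" by (intro order_le_less_trans[OF INF_lower])
  moreover have "0 \<le> ?V"
    by (intro INF_greatest hitting_time_nonneg cont)
  \<comment> \<open>The infimum is finite, so \<open>real_of_ereal\<close> loses nothing.\<close>
  ultimately have V: "?V = ereal (min_time \<tau> f U K x)"
    unfolding min_time_def by (cases ?V) auto
  then have "?V < ereal (min_time \<tau> f U K x + e)" using \<open>e > 0\<close> by simp
  then obtain u where u: "u \<in> controls U" "hitting_time \<tau> f K x u < ereal (min_time \<tau> f U K x + e)"
    by (auto simp: INF_less_iff)
  then have "hitting_time \<tau> f K x u < \<infinity>" by auto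
  then obtain t where "t \<ge> 0" "flow x u t \<in> K" "hitting_time \<tau> f K x u = ereal t"
    by (rule hitting_time_finiteD[OF cont u(1)])
  with u show thesis by (intro that[of u t]) auto
qed

section \<open>Stability under perturbation of the datum\<close>

lemma reachability_perturbation:
  assumes x: "x \<in> mspace (Lip_space N \<tau>)" and x': "x' \<in> mspace (Lip_space N \<tau>)"
    and u: "u \<in> controls U" and t: "t \<ge> 0" "flow x u t \<in> K" "t \<le> real k * \<tau>"
    and near: "(1 + L * \<tau>) ^ k * mdist (Lip_space N \<tau>) x x' < radius"
  shows "x' \<in> reachable_Lip N \<tau> f U K"
    and "min_time \<tau> f U K x' \<le> t + time_const * ((1 + L * \<tau>) ^ k * mdist (Lip_space N \<tau>) x x')"
proof -
  have lip: "N-lipschitz_on {-\<tau>..0} x" "N-lipschitz_on {-\<tau>..0} x'"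
    using x x' by (auto simp: mspace_Lip_space_iff)
  note cont = lip[THEN lipschitz_on_continuous_on]
  \<comment> \<open>The control that is good for \<open>x\<close> is run from \<open>x'\<close> as
    well; the gap left at time \<open>t\<close> is then closed by local reachability.\<close>
  have "infdist (flow x' u t) K \<le> dist (flow x' u t) (flow x u t)"
    using t by (intro infdist_le)
  also have "\<dots> \<le> (1 + L * \<tau>) ^ k * mdist (Lip_space N \<tau>) x x'"
    unfolding dist_norm norm_minus_commute[of "flow x' u t"]
    using cont u t tau_pos norm_diff_le_mdist_Lip_space[OF x x'] by (intro flow_dependence) auto
  finally have le: "infdist (flow x' u t) K \<le> (1 + L * \<tau>) ^ k * mdist (Lip_space N \<tau>) x x'" .
  then obtain w r where w: "w \<in> controls U" "r \<ge> 0" "flow x' w r \<in> K"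
    "r \<le> t + time_const * infdist (flow x' u t) K"
    using local_reachability[OF lip(2) u t(1)] near by auto
  have "hitting_time \<tau> f K x' w < \<infinity>"
    using hitting_time_le(1)[OF cont(2) w(1-3)] by (rule order_le_less_trans) simp
  then show "x' \<in> reachable_Lip N \<tau> f U K"
    using w(1) x' cont by (auto simp: reachable_Lip_def reachable_def mspace_history_space_iff mspace_Lip_space_iff)
  have "min_time \<tau> f U K x' \<le> r" using min_time_le[OF cont(2) w(1-3)] .
  also note w(4)
  also have "time_const * infdist (flow x' u t) K \<le> time_const * ((1 + L * \<tau>) ^ k * mdist (Lip_space N \<tau>) x x')"
    using time_const_nonneg le by (intro mult_left_mono)
  finally show "min_time \<tau> f U K x' \<le> t + time_const * ((1 + L * \<tau>) ^ k * mdist (Lip_space N \<tau>) x x')"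
    by simp
qed

text \<open>A bound on the minimum time over a small ball allows one growth factor for all its
  points, which makes the perturbation estimate uniform.\<close>

lemma reachable_ball:
  assumes "x0 \<in> reachable_Lip N \<tau> f U K"
  obtains r B where "r > 0"
    "\<And>x. x \<in> mspace (Lip_space N \<tau>) \<Longrightarrow> mdist (Lip_space N \<tau>) x0 x < r \<Longrightarrow> x \<in> reachable_Lip N \<tau> f U K"
    "\<And>x x'. x \<in> mspace (Lip_space N \<tau>) \<Longrightarrow> x' \<in> mspace (Lip_space N \<tau>) \<Longrightarrow>
       mdist (Lip_space N \<tau>) x0 x < r \<Longrightarrow> mdist (Lip_space N \<tau>) x0 x' < r \<Longrightarrow>
       min_time \<tau> f U K x' \<le> min_time \<tau> f U K x + B * mdist (Lip_space N \<tau>) x x'"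
proof -
  let ?d = "mdist (Lip_space N \<tau>)" and ?T = "min_time \<tau> f U K"
  interpret X: Metric_space "mspace (Lip_space N \<tau>)" ?d by (rule Metric_space_mspace_mdist)
  have x0: "x0 \<in> reachable \<tau> f U K" "x0 \<in> mspace (Lip_space N \<tau>)"
    using assms by (auto simp: reachable_Lip_def)
  obtain u0 t0 where u0: "u0 \<in> controls U" "t0 \<ge> 0" "flow x0 u0 t0 \<in> K" "t0 < min_time \<tau> f U K x0 + 1"
    by (rule min_time_approx[OF x0(1) zero_less_one])
  \<comment> \<open>Minimum times on the ball stay below \<open>t0 + time_const * radius\<close>;
    the extra 1 leaves room for near-optimal times.\<close>
  obtain k where k: "t0 + time_const * radius + 1 \<le> real k * \<tau>" using exists_nat_mult_delay_ge by blast
  define G where "G = (1 + L * \<tau>) ^ k"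
  have "G > 0" using L_pos tau_pos by (simp add: G_def add_pos_pos)
  have nn: "0 \<le> time_const * radius" using time_const_nonneg radius_pos by simp
  \<comment> \<open>Two points of the ball are less than \<open>2 * r\<close> apart, and this
    distance times \<open>G\<close> must stay below \<open>radius\<close>.\<close>
  define r where "r = radius / (2 * G)"
  have r: "r > 0" using radius_pos \<open>G > 0\<close> by (simp add: r_def)
  have G_near: "G * a < radius" if "a < 2 * r" for a
    using that \<open>G > 0\<close> by (simp add: r_def pos_less_divide_eq mult.commute)
  have ball: "x \<in> reachable_Lip N \<tau> f U K" "?T x \<le> t0 + time_const * radius"
    if x: "x \<in> mspace (Lip_space N \<tau>)" "?d x0 x < r" for x
  proof -
    have near: "G * ?d x0 x < radius" using x r by (intro G_near) simp
    have "t0 \<le> real k * \<tau>" using k nn by simp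
    note * = reachability_perturbation[OF x0(2) x(1) u0(1-3) this near[unfolded G_def], folded G_def]
    show "x \<in> reachable_Lip N \<tau> f U K" by (rule *(1))
    have "time_const * (G * ?d x0 x) \<le> time_const * radius"
      using near time_const_nonneg by (intro mult_left_mono) auto
    with *(2) show "?T x \<le> t0 + time_const * radius" by simp
  qed
  have "?T x' \<le> ?T x + time_const * G * ?d x x'"
    if x: "x \<in> mspace (Lip_space N \<tau>)" "x' \<in> mspace (Lip_space N \<tau>)" "?d x0 x < r" "?d x0 x' < r" for x x'
  proof (rule field_le_epsilon)
    fix e :: real assume "e > 0"
    have "?d x x' < 2 * r"
      using X.triangle''[of x x' x0] x x0 X.commute[of x x0] X.triangle[of x x0 x'] by simp
    then have near: "G * ?d x x' < radius" by (rule G_near)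
    have "x \<in> reachable \<tau> f U K" using ball(1)[OF x(1,3)] by (simp add: reachable_Lip_def)
    \<comment> \<open>Capping the slack at 1 keeps \<open>t\<close> below
      \<open>k * \<tau>\<close>.\<close>
    moreover have "min e 1 > 0" using \<open>e > 0\<close> by simp
    ultimately obtain u t where u: "u \<in> controls U" "t \<ge> 0" "flow x u t \<in> K" "t < ?T x + min e 1"
      by (rule min_time_approx)
    have "t \<le> real k * \<tau>" using u(4) ball(2)[OF x(1,3)] k by simp
    from reachability_perturbation(2)[OF x(1,2) u(1-3) this near[unfolded G_def], folded G_def] u(4)
    show "?T x' \<le> ?T x + time_const * G * ?d x x' + e" by (simp add: mult.assoc)
  qed
  with r ball(1) show thesis by (rule that)
qed

section \<open>Openness and local Lipschitz continuity\<close>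

lemma openin_reachable_Lip: "openin (mtopology_of (Lip_space N \<tau>)) (reachable_Lip N \<tau> f U K)"
proof -
  interpret X: Metric_space "mspace (Lip_space N \<tau>)" "mdist (Lip_space N \<tau>)"
    by (rule Metric_space_mspace_mdist)
  show ?thesis
    unfolding mtopology_of_def X.openin_mtopology
  proof (intro conjI allI impI)
    show "reachable_Lip N \<tau> f U K \<subseteq> mspace (Lip_space N \<tau>)" by (auto simp: reachable_Lip_def)
    fix x0 assume "x0 \<in> reachable_Lip N \<tau> f U K"
    then show "\<exists>r>0. X.mball x0 r \<subseteq> reachable_Lip N \<tau> f U K"
      using reachable_ball[of x0] by (metis X.in_mball subsetI)
  qed
qed

lemma locally_Lipschitz_min_time:
  "locally_Lipschitz_map (submetric (Lip_space N \<tau>) (reachable_Lip N \<tau> f U K)) euclidean_metric (min_time \<tau> f U K)"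
  unfolding locally_Lipschitz_map_def
proof
  let ?R = "reachable_Lip N \<tau> f U K" and ?d = "mdist (Lip_space N \<tau>)" and ?T = "min_time \<tau> f U K"
  define S where "S = submetric (Lip_space N \<tau>) ?R"
  have S: "mspace S = ?R \<inter> mspace (Lip_space N \<tau>)" "mdist S = ?d" by (simp_all add: S_def)
  interpret S: Metric_space "mspace S" "mdist S"
    by (rule Metric_space_mspace_mdist)
  fix x0 assume "x0 \<in> mspace (submetric (Lip_space N \<tau>) ?R)"
  then have x0: "x0 \<in> mspace S" by (simp add: S)
  then have "x0 \<in> ?R" by (simp add: S)
  then obtain r B where "r > 0" and B: "\<And>x x'. x \<in> mspace (Lip_space N \<tau>) \<Longrightarrow> x' \<in> mspace (Lip_space N \<tau>) \<Longrightarrow>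
       ?d x0 x < r \<Longrightarrow> ?d x0 x' < r \<Longrightarrow> ?T x' \<le> ?T x + B * ?d x x'"
    by (rule reachable_ball) blast
  have "Lipschitz_continuous_map (submetric S (S.mball x0 r)) euclidean_metric ?T"
    unfolding Lipschitz_continuous_map_def
  proof (intro conjI exI ballI)
    fix x x' assume x: "x \<in> mspace (submetric S (S.mball x0 r))" "x' \<in> mspace (submetric S (S.mball x0 r))"
    then have "x \<in> mspace S" "x' \<in> mspace S" "mdist S x0 x < r" "mdist S x0 x' < r"
      by auto
    \<comment> \<open>The one-sided estimate is used in both directions to bound the absolute
      difference.\<close>
    then have "?T x' \<le> ?T x + B * ?d x x'" "?T x \<le> ?T x' + B * ?d x' x"
      using B[of x x'] B[of x' x] by (auto simp: S)
    moreover have "?d x' x = ?d x x'" by (rule mdist_commute)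
    ultimately show "mdist euclidean_metric (?T x) (?T x') \<le> B * mdist (submetric S (S.mball x0 r)) x x'"
      by (simp add: dist_real_def S)
  qed simp
  moreover have "openin (mtopology_of S) (S.mball x0 r)"
    unfolding mtopology_of_def by (rule S.openin_mball)
  moreover have "x0 \<in> S.mball x0 r" using \<open>r > 0\<close> x0 by simp
  ultimately show "\<exists>V. openin (mtopology_of (submetric (Lip_space N \<tau>) ?R)) V \<and> x0 \<in> V \<and>
      Lipschitz_continuous_map (submetric (submetric (Lip_space N \<tau>) ?R) V) euclidean_metric ?T"
    unfolding S_def by blast
qed

end

theorem theorem3p3:
  fixes f :: "real ^ 'n \<Rightarrow> real ^ 'm \<Rightarrow> real ^ 'n"
    and U :: "(real ^ 'm) set" and K :: "(real ^ 'n) set"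
    and \<tau> M L \<mu> \<sigma> Mbar :: real
  assumes "\<tau> > 0"
    and "compact U"
    and "K \<noteq> {}" and "compact K"
    and "continuous_on (UNIV \<times> U) (\<lambda>(z, u). f z u)"
    and "M > 0" and "L > 0"
    and "\<And>z u. u \<in> U \<Longrightarrow> norm (f z u) \<le> M"
    and "\<And>z y u. u \<in> U \<Longrightarrow> norm (f z u - f y u) \<le> L * norm (z - y)"
    and "\<mu> > 0" and "\<sigma> > 0"
    and "\<And>x. x \<in> {z. infdist z K < \<sigma>} - K \<Longrightarrow>
           \<exists>u\<in>U. \<exists>p\<in>K. infdist x K = norm (x - p) \<and>
             f x u \<bullet> ((x - p) /\<^sub>R norm (x - p)) \<le> - \<mu>"
    and "Mbar > 0"
    and "\<tau> < \<mu> / (2 * max M Mbar * L)"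
  shows "openin (mtopology_of (Lip_space (max M Mbar) \<tau>)) (reachable_Lip (max M Mbar) \<tau> f U K) \<and>
         locally_Lipschitz_map
           (submetric (Lip_space (max M Mbar) \<tau>) (reachable_Lip (max M Mbar) \<tau> f U K))
           euclidean_metric (min_time \<tau> f U K)"
proof -
  interpret controlled_delay_system f U \<tau> M L K \<mu> \<sigma> "max M Mbar"
  proof unfold_locales
    have "\<mu> / (2 * max M Mbar * L) \<le> \<mu> / (max M Mbar * L)"
      using assms(6,7,10) by (intro divide_left_mono) auto
    with assms(14) show "\<tau> < \<mu> / (max M Mbar * L)" by simp
  qed (use assms in \<open>auto intro: compact_imp_closed\<close>)
  show ?thesis
    using openin_reachable_Lip locally_Lipschitz_min_time by blast
qed

end
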